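(* Let $\{\lambda_n\}_{n=0}^\infty$ be a sequence in $\partial\mathbb{D}$, and let $\alpha_n$ and $\beta_n$ be the Verblunsky coefficients of the nontrivial probability measures $d\mu=w(\theta)\frac{d\theta}{2\pi}+d\mu_{\mathrm{s}}$ and $d\nu=f(\theta)\frac{d\theta}{2\pi}+d\nu_{\mathrm{s}}$ on $\partial\mathbb{D}$, respectively, where $d\mu_{\mathrm{s}},d\nu_{\mathrm{s}}$ are singular with respect to $d\theta$. Suppose that $$\sum_{j=0}^\infty\bigl(|\lambda_j\alpha_j-\beta_j|+|\lambda_{j+1}\bar\lambda_j-1|\bigr)<\infty.$$ Then $\{\theta\mid w(\theta)\neq0\}=\{\theta\mid f(\theta)\neq0\}$ up to sets of $\frac{d\theta}{2\pi}$-measure $0$.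
   Context: $\mathbb{D}=\{|z|<1\}$. A probability measure on $\partial\mathbb{D}$ is nontrivial if it is not a finite combination of delta functions. For such $\mu$, $\Phi_n$ is the monic orthogonal polynomial of degree $n$ in $L^2(\partial\mathbb{D},d\mu)$ and the Verblunsky coefficients are $\alpha_n=-\overline{\Phi_{n+1}(0)}\in\mathbb{D}$, $n\ge0$. *)

theory Defs
  imports "HOL-Probability.Probability" "HOL-Computational_Algebra.Polynomial"
begin

definition circle_borel :: "complex measure" where
  "circle_borel = restrict_space borel (sphere 0 1)"

definition finite_combination_of_deltas :: "complex measure \<Rightarrow> bool" where
  "finite_combination_of_deltas \<mu> \<longleftrightarrow>
     (\<exists>S (c :: complex \<Rightarrow> real). finite S \<and>
        (\<forall>A \<in> sets \<mu>. measure \<mu> A = (\<Sum>z\<in>S. c z * indicator A z)))"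

definition nontrivial_prob_on_circle :: "complex measure \<Rightarrow> bool" where
  "nontrivial_prob_on_circle \<mu> \<longleftrightarrow>
     sets \<mu> = sets circle_borel \<and> prob_space \<mu> \<and> \<not> finite_combination_of_deltas \<mu>"

definition L2_inner :: "complex measure \<Rightarrow> complex poly \<Rightarrow> complex poly \<Rightarrow> complex" where
  "L2_inner \<mu> q p = (\<integral>z. cnj (poly q z) * poly p z \<partial>\<mu>)"

text \<open>For a nontrivial probability measure the polynomial described here exists and is unique;
  for other measures the value is unspecified.\<close>

definition monic_OP :: "complex measure \<Rightarrow> nat \<Rightarrow> complex poly" where
  "monic_OP \<mu> n =
     (THE p. degree p = n \<and> lead_coeff p = 1 \<and> (\<forall>q. degree q < n \<longrightarrow> L2_inner \<mu> q p = 0))"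

definition verblunsky :: "complex measure \<Rightarrow> nat \<Rightarrow> complex" where
  "verblunsky \<mu> n = - cnj (poly (monic_OP \<mu> (Suc n)) 0)"

text \<open>The measure \<open>d\<theta>/2\<pi>\<close>: the angle \<open>\<theta>\<close> ranges over \<open>[0, 2\<pi>)\<close>, and the complement
  of this interval is a null set. Points of the circle are \<open>cis \<theta>\<close>.\<close>

definition dtheta :: "real measure" where
  "dtheta = uniform_measure lborel {0..<2 * pi}"

definition dtheta_circle :: "complex measure" where
  "dtheta_circle = distr dtheta circle_borel cis"

definition mutually_singular :: "'a measure \<Rightarrow> 'a measure \<Rightarrow> bool" where
  "mutually_singular M N \<longleftrightarrow>
     sets M = sets N \<and>
     (\<exists>A \<in> sets M. emeasure M A = 0 \<and> emeasure N (space N - A) = 0)"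

text \<open>\<open>d\<mu> = w(\<theta>) d\<theta>/2\<pi> + d\<mu>\<^sub>s\<close>. The nonnegativity condition is needed because \<open>ennreal\<close>
  sends negative reals to \<open>0\<close>.\<close>

definition lebesgue_decomposition ::
    "complex measure \<Rightarrow> (real \<Rightarrow> real) \<Rightarrow> complex measure \<Rightarrow> bool" where
  "lebesgue_decomposition \<mu> w \<mu>s \<longleftrightarrow>
     w \<in> borel_measurable dtheta \<and> (AE \<theta> in dtheta. 0 \<le> w \<theta>) \<and>
     mutually_singular \<mu>s dtheta_circle \<and>
     (\<forall>A \<in> sets \<mu>. emeasure \<mu> A =
        emeasure (distr (density dtheta (\<lambda>\<theta>. ennreal (w \<theta>))) circle_borel cis) A + emeasure \<mu>s A)"

end

theory Submission
  imports Defs "HOL-Complex_Analysis.Complex_Analysis" "HOL-Real_Asymp.Real_Asymp"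
begin

text \<open>
  Let \<open>\<phi>\<^sub>n\<close> be the orthonormal polynomials of \<open>\<mu>\<close>, \<open>\<psi>\<^sub>n\<close> those with Verblunsky coefficients \<open>-\<alpha>\<^sub>n\<close>,
  and \<open>x\<^sub>n\<close> the orthonormal polynomials of \<open>\<nu>\<close>. On the circle the weights
  \<open>G\<^sub>N = min w \<bar>\<psi>\<^sub>N\<bar>\<^sup>-\<^sup>2\<close> satisfy \<open>\<integral> G\<^sub>N (\<bar>\<phi>\<^sub>n\<bar>\<^sup>2 + \<bar>\<psi>\<^sub>n\<bar>\<^sup>2) \<le> 2\<close> for all \<open>n \<le> N\<close>. Conjugating the transfer
  matrices of \<open>\<nu>\<close> by \<open>diag(1, \<lambda>\<^sub>n)\<close> turns them into a summable perturbation of those of \<open>\<mu>\<close>, and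
  variation of parameters bounds \<open>ln \<bar>x\<^sub>N\<bar>\<close> by \<open>O(1) + (\<bar>\<phi>\<^sub>N\<bar> + \<bar>\<psi>\<^sub>N\<bar>)\<^sup>2\<close> plus a sum of the squares
  \<open>(\<bar>\<phi>\<^sub>n\<bar> + \<bar>\<psi>\<^sub>n\<bar>)\<^sup>2\<close>, \<open>n \<le> N\<close>, with summable coefficients. Hence \<open>\<integral> G\<^sub>N ln\<^sup>+ \<bar>x\<^sub>N\<bar>\<close> is bounded uniformly in \<open>N\<close>.
  If \<open>\<nu>\<close> vanished on a compact set of positive Lebesgue measure on which \<open>w \<ge> \<delta> > 0\<close>, then weak convergence of
  the Bernstein--Szego measures \<open>\<bar>x\<^sub>N\<bar>\<^sup>-\<^sup>2 d\<theta>/2\<pi>\<close> to \<open>\<nu>\<close> would force \<open>\<bar>x\<^sub>N\<bar> \<rightarrow> \<infinity>\<close> in measure there.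
  This contradicts the bound, since \<open>\<bar>\<psi>\<^sub>N\<bar> = \<bar>\<phi>\<^sub>N\<bar> \<bar>F\<^sub>N\<bar>\<close> for a Caratheodory function \<open>F\<^sub>N\<close>, whose weak-type
  estimate keeps \<open>G\<^sub>N\<close> bounded below off a small set.
\<close>

subsection \<open>The Szego recursion\<close>

definition rho :: "complex \<Rightarrow> real" where
  "rho a = sqrt (1 - (cmod a)\<^sup>2)"

lemma rho_pos: "cmod a < 1 \<Longrightarrow> rho a > 0"
  by (simp add: rho_def abs_square_less_1)

lemma rho_sq: "cmod a < 1 \<Longrightarrow> (rho a)\<^sup>2 = 1 - (cmod a)\<^sup>2"
  unfolding rho_def by (rule real_sqrt_pow2) (metis abs_norm_cancel abs_square_less_1 diff_ge_0_iff_ge less_imp_le)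

lemma rho_mult_self: "cmod a < 1 \<Longrightarrow> complex_of_real (rho a) * of_real (rho a) = 1 - a * cnj a"
  using rho_sq[of a] complex_norm_square[of a]
  by (metis of_real_1 of_real_diff of_real_mult power2_eq_square)

lemma rho_le_1: "rho a \<le> 1"
  by (simp add: rho_def)

lemma rho_uminus [simp]: "rho (- a) = rho a"
  by (simp add: rho_def)

text \<open>Orthonormal polynomials \<open>\<phi>\<^sub>n\<close> and their reversals \<open>\<phi>\<^sub>n\<^sup>* = z\<^sup>n cnj (\<phi>\<^sub>n (1 / cnj z))\<close>, defined by the
  recursion for given Verblunsky coefficients, without reference to a measure.\<close>

fun opoly ropoly :: "(nat \<Rightarrow> complex) \<Rightarrow> nat \<Rightarrow> complex poly" where
  "opoly a 0 = 1"
| "opoly a (Suc n) =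
     smult (of_real (1 / rho (a n))) (pCons 0 (opoly a n) - smult (cnj (a n)) (ropoly a n))"
| "ropoly a 0 = 1"
| "ropoly a (Suc n) =
     smult (of_real (1 / rho (a n))) (ropoly a n - smult (a n) (pCons 0 (opoly a n)))"

text \<open>The reciprocal of the leading coefficient of \<open>opoly a n\<close>. In a measure for
  which these polynomials are orthonormal, it is the norm of the monic orthogonal polynomial of
  degree \<open>n\<close>.\<close>

definition rho_prod :: "(nat \<Rightarrow> complex) \<Rightarrow> nat \<Rightarrow> real" where
  "rho_prod a n = (\<Prod>k<n. rho (a k))"

lemma rho_prod_pos: "(\<And>k. k < n \<Longrightarrow> cmod (a k) < 1) \<Longrightarrow> rho_prod a n > 0"
  unfolding rho_prod_def by (rule prod_pos) (auto intro: rho_pos)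

lemma rho_prod_Suc: "rho_prod a (Suc n) = rho_prod a n * rho (a n)"
  by (simp add: rho_prod_def)

lemma poly_opoly_Suc:
  "poly (opoly a (Suc n)) z =
     (z * poly (opoly a n) z - cnj (a n) * poly (ropoly a n) z) / of_real (rho (a n))"
  by (simp add: field_simps)

lemma poly_ropoly_Suc:
  "poly (ropoly a (Suc n)) z =
     (poly (ropoly a n) z - a n * z * poly (opoly a n) z) / of_real (rho (a n))"
  by (simp add: field_simps)

text \<open>The facts need a joint induction because each step mixes the two families. At index
  \<open>Suc n\<close> only the shifted \<open>opoly\<close> contributes, and at index
  \<open>0\<close> only \<open>ropoly\<close>.\<close>

lemma coeff_opoly_ropoly:
  "(\<forall>k>n. coeff (opoly a n) k = 0) \<and> (\<forall>k>n. coeff (ropoly a n) k = 0) \<and>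
     coeff (opoly a n) n = of_real (1 / rho_prod a n) \<and>
     coeff (ropoly a n) 0 = of_real (1 / rho_prod a n)"
proof (induction n)
  case (Suc n)
  then show ?case
    by (auto simp: coeff_pCons rho_prod_Suc field_simps split: nat.splits)
qed (auto simp: rho_prod_def coeff_1)

lemma degree_opoly_le: "degree (opoly a n) \<le> n"
  using coeff_opoly_ropoly by (intro degree_le) blast

lemma degree_ropoly_le: "degree (ropoly a n) \<le> n"
  using coeff_opoly_ropoly by (intro degree_le) blast

lemma coeff_opoly_top: "coeff (opoly a n) n = of_real (1 / rho_prod a n)"
  using coeff_opoly_ropoly by blast

lemma poly_ropoly_0: "poly (ropoly a n) 0 = of_real (1 / rho_prod a n)"
  unfolding poly_0_coeff_0 using coeff_opoly_ropoly by blast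

lemma circle_mult_cnj: "cmod z = 1 \<Longrightarrow> z * cnj z = 1"
  by (simp add: complex_norm_square[symmetric])

text \<open>On the circle conjugation inverts \<open>z\<close>, so the conjugated recursion for
  \<open>opoly\<close>, multiplied by the right power of \<open>z\<close>, is the recursion for
  \<open>ropoly\<close>.\<close>

lemma ropoly_circle:
  assumes "cmod z = 1"
  shows "poly (ropoly a n) z = z ^ n * cnj (poly (opoly a n) z)"
proof (induction n)
  case (Suc n)
  let ?p = "poly (opoly a n) z" and ?q = "poly (ropoly a n) z"
  have zz: "z ^ k * cnj z ^ k = 1" for k
    using circle_mult_cnj[OF assms] by (simp add: power_mult_distrib[symmetric])
  let ?P = "cnj ?p" and ?Q = "cnj ?q"
  have Q: "z ^ n * ?Q = ?p"
    unfolding Suc using zz[of n] by (simp add: mult.assoc[symmetric])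
  have "z ^ Suc n * cnj (poly (opoly a (Suc n)) z)
      = (z ^ n * (z * cnj z) * ?P - a n * z * (z ^ n * ?Q)) / of_real (rho (a n))"
    unfolding poly_opoly_Suc by (simp add: algebra_simps)
  also have "\<dots> = (?q - a n * z * ?p) / of_real (rho (a n))"
    unfolding Q circle_mult_cnj[OF assms] using Suc by simp
  finally show ?case
    unfolding poly_ropoly_Suc by (rule sym)
qed simp

lemma norm_ropoly_circle:
  "cmod z = 1 \<Longrightarrow> cmod (poly (ropoly a n) z) = cmod (poly (opoly a n) z)"
  by (simp add: ropoly_circle norm_mult norm_power)

text \<open>Polynomials of the second kind.\<close>

abbreviation opoly2 :: "(nat \<Rightarrow> complex) \<Rightarrow> nat \<Rightarrow> complex poly" where
  "opoly2 a \<equiv> opoly (\<lambda>k. - a k)"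

abbreviation ropoly2 :: "(nat \<Rightarrow> complex) \<Rightarrow> nat \<Rightarrow> complex poly" where
  "ropoly2 a \<equiv> ropoly (\<lambda>k. - a k)"

text \<open>Without its factor \<open>z\<close> the transfer matrix lies in SU(1,1), hence preserves
  this indefinite form.\<close>

lemma norm_sq_step:
  fixes x y :: complex and \<alpha> :: complex
  assumes "cmod \<alpha> < 1"
  shows "(cmod ((y - \<alpha> * x) / of_real (rho \<alpha>)))\<^sup>2 - (cmod ((x - cnj \<alpha> * y) / of_real (rho \<alpha>)))\<^sup>2
    = (cmod y)\<^sup>2 - (cmod x)\<^sup>2"
proof -
  have "(cmod (y - \<alpha> * x))\<^sup>2 - (cmod (x - cnj \<alpha> * y))\<^sup>2 = (1 - (cmod \<alpha>)\<^sup>2) * ((cmod y)\<^sup>2 - (cmod x)\<^sup>2)"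
    unfolding cmod_power2 by (simp add: power2_eq_square algebra_simps)
  then show ?thesis
    using rho_pos[OF assms] unfolding rho_sq[OF assms, symmetric]
    by (simp add: norm_divide power_divide diff_divide_distrib[symmetric])
qed

text \<open>The pair formed by negated \<open>opoly2\<close> and \<open>ropoly2\<close> solves the
  recursion for \<open>a\<close>, so the two combinations do as well. Multiplication by
  \<open>z\<close> shrinks the first one, and \<open>norm_sq_step\<close> then keeps it dominated by
  the second. The cases used later are \<open>s = 0\<close>, for the absence of zeros, and
  \<open>s = 1 / L\<close> in the weak-type estimate.\<close>

lemma ropoly_combination_disc:
  assumes a: "\<And>k. cmod (a k) < 1" and z: "cmod z \<le> 1" and s: "s \<ge> 0"
  shows "cmod (poly (opoly a n) z - of_real s * poly (opoly2 a n) z)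
           \<le> cmod (poly (ropoly a n) z + of_real s * poly (ropoly2 a n) z) \<and>
         poly (ropoly a n) z + of_real s * poly (ropoly2 a n) z \<noteq> 0"
proof (induction n)
  case 0
  have "cmod (1 - of_real s) \<le> cmod (1 + of_real s)"
    using s by (metis abs_of_nonneg abs_triangle_ineq4 abs_1 norm_of_real of_real_1 of_real_add of_real_diff
      abs_of_nonneg add_nonneg_nonneg zero_le_one)
  moreover have "(1::complex) + of_real s \<noteq> 0"
    using s by (metis add_nonneg_eq_0_iff of_real_1 of_real_add of_real_eq_0_iff zero_le_one zero_neq_one)
  ultimately show ?case by simp
next
  case (Suc n)
  define x where "x = poly (opoly a n) z - of_real s * poly (opoly2 a n) z"
  define y where "y = poly (ropoly a n) z + of_real s * poly (ropoly2 a n) z"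
  have xy: "cmod x \<le> cmod y" "y \<noteq> 0"
    using Suc by (auto simp: x_def y_def)
  have x': "poly (opoly a (Suc n)) z - of_real s * poly (opoly2 a (Suc n)) z
      = (z * x - cnj (a n) * y) / of_real (rho (a n))"
    unfolding poly_opoly_Suc x_def y_def
    by (simp add: diff_divide_distrib add_divide_distrib algebra_simps)
  have y': "poly (ropoly a (Suc n)) z + of_real s * poly (ropoly2 a (Suc n)) z
      = (y - a n * (z * x)) / of_real (rho (a n))"
    unfolding poly_ropoly_Suc x_def y_def
    by (simp add: diff_divide_distrib add_divide_distrib algebra_simps)
  have zx: "cmod (z * x) \<le> cmod y"
    using xy z by (metis mult_left_le_one_le norm_ge_zero norm_mult order_trans)
  have "cmod ((z * x - cnj (a n) * y) / of_real (rho (a n))) \<le> cmod ((y - a n * (z * x)) / of_real (rho (a n)))"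
    by (rule power2_le_imp_le) (use norm_sq_step[OF a[of n], of y "z * x"] power_mono[OF zx norm_ge_zero, of 2] in linarith, rule norm_ge_zero)
  moreover have "y \<noteq> a n * (z * x)"
  proof
    assume "y = a n * (z * x)"
    then have "cmod y \<le> cmod (a n) * cmod y"
      by (metis norm_mult mult_left_mono norm_ge_zero zx)
    then show False using a[of n] xy(2) by simp
  qed
  ultimately show ?case
    using rho_pos[OF a[of n]] unfolding x' y' by simp
qed

lemma ropoly_nz:
  assumes "\<And>k. cmod (a k) < 1" "cmod z \<le> 1"
  shows "poly (ropoly a n) z \<noteq> 0"
  using ropoly_combination_disc[of a z 0 n] assms by simp

lemma opoly_circle_nz:
  assumes "\<And>k. cmod (a k) < 1" "cmod z = 1"
  shows "poly (opoly a n) z \<noteq> 0"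
  using ropoly_nz[of a z n] assms ropoly_circle[of z a n] by auto

text \<open>The second pair evolves with the opposite coefficient; the identity reflects that a
  transfer matrix has determinant \<open>z\<close>. The four numbers are arbitrary so that
  \<open>opoly_perturbation\<close> can insert a vector that is not a solution.\<close>

lemma wronskian_step:
  fixes c z x1 x2 y1 y2 :: complex
  assumes "cmod c < 1"
  shows "(z * x1 - cnj c * x2) / of_real (rho c) * ((y2 + c * z * y1) / of_real (rho c))
      + (x2 - c * z * x1) / of_real (rho c) * ((z * y1 + cnj c * y2) / of_real (rho c))
    = z * (x1 * y2 + x2 * y1)"
proof -
  let ?r = "of_real (rho c) :: complex"
  have r: "?r \<noteq> 0" using rho_pos[OF assms] by simp
  have r2: "?r * ?r = 1 - c * cnj c" using assms by (rule rho_mult_self)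
  have "(z * x1 - cnj c * x2) / ?r * ((y2 + c * z * y1) / ?r)
      + (x2 - c * z * x1) / ?r * ((z * y1 + cnj c * y2) / ?r)
     = ((z * x1 - cnj c * x2) * (y2 + c * z * y1) + (x2 - c * z * x1) * (z * y1 + cnj c * y2)) / (?r * ?r)"
    by (simp only: times_divide_times_eq add_divide_distrib[symmetric])
  also have "(z * x1 - cnj c * x2) * (y2 + c * z * y1) + (x2 - c * z * x1) * (z * y1 + cnj c * y2)
     = (?r * ?r) * (z * (x1 * y2 + x2 * y1))"
    unfolding r2 by (simp add: algebra_simps)
  also have "\<dots> / (?r * ?r) = z * (x1 * y2 + x2 * y1)"
    using r by simp
  finally show ?thesis .
qed

lemma wronskian:
  assumes a: "\<And>k. cmod (a k) < 1"
  shows "poly (opoly a n) z * poly (ropoly2 a n) z + poly (ropoly a n) z * poly (opoly2 a n) z = 2 * z ^ n"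
proof (induction n)
  case (Suc n)
  then show ?case
    using wronskian_step[OF a[of n], of z "poly (opoly a n) z" "poly (ropoly a n) z"
        "poly (ropoly2 a n) z" "poly (opoly2 a n) z"]
    unfolding poly_opoly_Suc poly_ropoly_Suc by simp
qed simp

text \<open>The terms with \<open>a n\<close> cancel and leave the factor
  \<open>1 / rho (a n)\<close>. Solutions bounded at two consecutive levels thus force
  \<open>rho\<close> away from zero.\<close>

lemma wronskian_shift:
  assumes a: "\<And>k. cmod (a k) < 1"
  shows "poly (opoly2 a n) z * poly (ropoly a (Suc n)) z + poly (opoly a n) z * poly (ropoly2 a (Suc n)) z
    = 2 * z ^ n / of_real (rho (a n))"
  unfolding wronskian[of a n z, OF a, symmetric] poly_ropoly_Suc
  by (simp add: diff_divide_distrib add_divide_distrib algebra_simps)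

subsection \<open>Integration on the circle\<close>

lemma space_circle_borel [simp]: "space circle_borel = sphere 0 1"
  by (simp add: circle_borel_def space_restrict_space)

lemma borel_measurable_circle [measurable (raw)]:
  "f \<in> borel_measurable borel \<Longrightarrow> f \<in> borel_measurable circle_borel"
  unfolding circle_borel_def by (rule measurable_restrict_space1)

lemma borel_measurable_circle_continuous:
  "continuous_on (sphere 0 1) f \<Longrightarrow> f \<in> borel_measurable circle_borel"
  unfolding circle_borel_def by (rule borel_measurable_continuous_on_restrict)

lemma compact_sets_circle_borel:
  assumes "compact C" "C \<subseteq> sphere 0 1"
  shows "C \<in> sets circle_borel"
proof -
  have "C = sphere 0 1 \<inter> C" using assms(2) by auto
  then show ?thesis
    unfolding circle_borel_def sets_restrict_space using borel_compact[OF assms(1)] by blast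
qed

lemma borel_measurable_cis [measurable]: "cis \<in> borel_measurable borel"
  by (intro borel_measurable_continuous_onI continuous_intros)

lemma cis_measurable_circle [measurable]: "cis \<in> measurable borel circle_borel"
  unfolding circle_borel_def by (rule measurable_restrict_space2) auto

lemma sets_dtheta [measurable_cong, simp]: "sets dtheta = sets borel"
  by (simp add: dtheta_def)

lemma space_dtheta [simp]: "space dtheta = UNIV"
  by (simp add: dtheta_def)

lemma sets_dtheta_circle [measurable_cong, simp]: "sets dtheta_circle = sets circle_borel"
  by (simp add: dtheta_circle_def)

lemma space_dtheta_circle [simp]: "space dtheta_circle = sphere 0 1"
  by (simp add: dtheta_circle_def)

interpretation dtheta: prob_space dtheta
  unfolding dtheta_def by (rule prob_space_uniform_measure) auto

interpretation dtheta_circle: prob_space dtheta_circle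
  unfolding dtheta_circle_def by (rule dtheta.prob_space_distr) measurable

lemma integral_dtheta_circle:
  fixes g :: "complex \<Rightarrow> 'b::{banach, second_countable_topology}"
  assumes "g \<in> borel_measurable circle_borel"
  shows "integral\<^sup>L dtheta_circle g = (\<integral>\<theta>. g (cis \<theta>) \<partial>dtheta)"
  unfolding dtheta_circle_def by (rule integral_distr) (use assms in measurable)

lemma integral_dtheta:
  fixes g :: "real \<Rightarrow> 'b::euclidean_space"
  assumes g: "continuous_on {0..2 * pi} g" and gm: "g \<in> borel_measurable borel"
  shows "integral\<^sup>L dtheta g = integral {0..2 * pi} g /\<^sub>R (2 * pi)"
proof -
  have c: "1 / ennreal (2 * pi) = ennreal (1 / (2 * pi))"
    by (simp add: divide_ennreal ennreal_1[symmetric] del: ennreal_1)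
  have D: "dtheta = density lborel (\<lambda>x. ennreal (indicator {0..<2 * pi} x / (2 * pi)))"
    unfolding dtheta_def uniform_measure_def
    by (intro density_cong AE_I2) (auto simp: c split: split_indicator)
  have "integral\<^sup>L dtheta g = (\<integral>x. (indicator {0..<2 * pi} x / (2 * pi)) *\<^sub>R g x \<partial>lborel)"
    unfolding D by (rule integral_density) (use gm in auto)
  also have "\<dots> = (\<integral>x. (1 / (2 * pi)) *\<^sub>R (indicator {0..2 * pi} x *\<^sub>R g x) \<partial>lborel)"
  proof (rule integral_cong_AE)
    show "AE x in lborel. (indicator {0..<2 * pi} x / (2 * pi)) *\<^sub>R g x
        = (1 / (2 * pi)) *\<^sub>R (indicator {0..2 * pi} x *\<^sub>R g x)"
      using AE_lborel_singleton[of "2 * pi"]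
      by eventually_elim (auto split: split_indicator)
  qed (use gm in measurable)
  also have "\<dots> = (1 / (2 * pi)) *\<^sub>R (LINT x : {0..2 * pi} | lborel. g x)"
    by (simp only: set_lebesgue_integral_def integral_scaleR_right)
  also have "(LINT x : {0..2 * pi} | lborel. g x) = integral {0..2 * pi} g"
    using borel_integrable_atLeastAtMost'[OF g] by (rule set_borel_integral_eq_integral(2))
  finally show ?thesis by (simp only: inverse_eq_divide)
qed

text \<open>Cauchy's integral formula at the centre; the derivative \<open>\<i> * cis t\<close> of
  the path cancels the denominator.\<close>

lemma mean_value_circle:
  assumes hol: "g holomorphic_on ball 0 1" and cont: "continuous_on (cball 0 1) g"
  shows "integral\<^sup>L dtheta_circle g = g 0"
proof -
  have gm: "g \<in> borel_measurable circle_borel"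
    by (rule borel_measurable_circle_continuous) (use cont continuous_on_subset in force)
  have c: "continuous_on UNIV (\<lambda>\<theta>. g (cis \<theta>))"
    by (rule continuous_on_compose2[OF cont]) (auto intro!: continuous_intros)
  have "((\<lambda>u. g u / (u - 0)) has_contour_integral (2 * of_real pi * \<i> * g 0)) (circlepath 0 1)"
    by (rule Cauchy_integral_circlepath[OF cont hol]) simp
  then have "((\<lambda>t. g (cis t) / cis t * \<i> * cis t) has_integral (2 * of_real pi * \<i> * g 0)) {0..2 * pi}"
    unfolding circlepath_def by (simp add: has_contour_integral_part_circlepath_iff)
  then have "((\<lambda>t. g (cis t) * \<i>) has_integral (2 * of_real pi * g 0) * \<i>) {0..2 * pi}"
    by (simp add: mult_ac)
  then have "((\<lambda>t. g (cis t) * \<i> * (- \<i>)) has_integral (2 * of_real pi * g 0) * \<i> * (- \<i>)) {0..2 * pi}"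
    by (rule has_integral_mult_left)
  then have "((\<lambda>t. g (cis t)) has_integral 2 * of_real pi * g 0) {0..2 * pi}"
    by (simp add: mult.assoc)
  then have "integral {0..2 * pi} (\<lambda>t. g (cis t)) = 2 * of_real pi * g 0"
    by (rule integral_unique)
  moreover have "(\<integral>\<theta>. g (cis \<theta>) \<partial>dtheta) = integral {0..2 * pi} (\<lambda>t. g (cis t)) /\<^sub>R (2 * pi)"
    by (rule integral_dtheta) (use c in \<open>auto intro: continuous_on_subset borel_measurable_continuous_onI\<close>)
  ultimately show ?thesis
    by (simp add: integral_dtheta_circle[OF gm] scaleR_conv_of_real)
qed

subsection \<open>Orthogonality and Bernstein--Szego measures\<close>

text \<open>Finiteness instead of total mass 1, since the Bernstein-Szego densities enter before
  their mass is computed.\<close>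

locale circle_measure = finite_measure M for M :: "complex measure" +
  assumes sets_M [measurable_cong]: "sets M = sets circle_borel"
begin

lemma space_M: "space M = sphere 0 1"
  using sets_eq_imp_space_eq[OF sets_M] by simp

lemma integrable_continuous:
  fixes g :: "complex \<Rightarrow> 'b::{banach, second_countable_topology}"
  assumes "continuous_on (sphere 0 1) g"
  shows "integrable M g"
proof -
  have "compact (g ` sphere 0 1)"
    using assms by (intro compact_continuous_image) auto
  then obtain B where "\<forall>x\<in>sphere 0 1. norm (g x) \<le> B"
    by (auto dest!: compact_imp_bounded simp: bounded_iff)
  moreover have "g \<in> borel_measurable circle_borel"
    using assms by (rule borel_measurable_circle_continuous)
  then have "g \<in> borel_measurable M"
    using sets_M by (simp cong: measurable_cong_sets)
  ultimately show ?thesis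
    by (intro integrable_const_bound[where B = B]) (auto intro!: AE_I2 simp: space_M)
qed

lemma integrable_L2 [simp]: "integrable M (\<lambda>z. cnj (poly q z) * poly p z)"
  by (intro integrable_continuous continuous_intros)

lemma integral_cong_circle:
  "(\<And>z. cmod z = 1 \<Longrightarrow> f z = g z) \<Longrightarrow> integral\<^sup>L M f = integral\<^sup>L M g"
  by (rule Bochner_Integration.integral_cong) (auto simp: space_M)

lemma L2_add: "L2_inner M q (p + p') = L2_inner M q p + L2_inner M q p'"
  by (simp add: L2_inner_def distrib_left)

lemma L2_smult: "L2_inner M q (smult c p) = c * L2_inner M q p"
  by (simp add: L2_inner_def mult.left_commute[of _ c])

lemma L2_diff: "L2_inner M q (p - p') = L2_inner M q p - L2_inner M q p'"
  using L2_add[of q p "smult (- 1) p'"] unfolding L2_smult by simp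

lemma L2_zero [simp]: "L2_inner M q 0 = 0"
  by (simp add: L2_inner_def)

lemma L2_sum: "finite A \<Longrightarrow> L2_inner M q (\<Sum>i\<in>A. p i) = (\<Sum>i\<in>A. L2_inner M q (p i))"
  by (induction A rule: finite_induct) (auto simp: L2_add)

lemma L2_cnj: "L2_inner M q p = cnj (L2_inner M p q)"
proof -
  have "(\<integral>z. cnj (cnj (poly p z) * poly q z) \<partial>M) = cnj (\<integral>z. cnj (poly p z) * poly q z \<partial>M)"
    by (rule integral_bounded_linear[OF bounded_linear_cnj integrable_L2])
  moreover have "cnj (cnj (poly p z) * poly q z) = cnj (poly q z) * poly p z" for z
    by simp
  ultimately show ?thesis
    by (simp only: L2_inner_def)
qed

text \<open>Multiplication by \<open>z\<close> is unitary because \<open>z * cnj z = 1\<close> on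
  the circle.\<close>

lemma L2_pCons: "L2_inner M (pCons 0 q) (pCons 0 p) = L2_inner M q p"
  unfolding L2_inner_def
proof (rule integral_cong_circle)
  fix z :: complex assume "cmod z = 1"
  have "cnj (poly (pCons 0 q) z) * poly (pCons 0 p) z = (z * cnj z) * (cnj (poly q z) * poly p z)"
    by (simp add: algebra_simps)
  then show "cnj (poly (pCons 0 q) z) * poly (pCons 0 p) z = cnj (poly q z) * poly p z"
    using circle_mult_cnj[OF \<open>cmod z = 1\<close>] by simp
qed

lemma L2_monom_shift: "L2_inner M (monom 1 (Suc k)) (pCons 0 p) = L2_inner M (monom 1 k) p"
  by (simp add: monom_Suc L2_pCons)

lemma L2_expand:
  assumes "degree p \<le> n"
  shows "L2_inner M q p = (\<Sum>k\<le>n. coeff p k * L2_inner M q (monom 1 k))"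
proof -
  have "p = (\<Sum>k\<le>n. smult (coeff p k) (monom 1 k))"
    using poly_as_sum_of_monoms'[OF assms] by (simp add: smult_monom)
  then have "L2_inner M q p = L2_inner M q (\<Sum>k\<le>n. smult (coeff p k) (monom 1 k))"
    by simp
  then show ?thesis by (simp add: L2_sum L2_smult)
qed

lemma L2_expand_left:
  assumes "degree q \<le> n"
  shows "L2_inner M q p = (\<Sum>k\<le>n. cnj (coeff q k) * L2_inner M (monom 1 k) p)"
proof -
  have "L2_inner M q p = cnj (L2_inner M p q)" by (rule L2_cnj)
  also have "\<dots> = (\<Sum>k\<le>n. cnj (coeff q k) * cnj (L2_inner M p (monom 1 k)))"
    by (subst L2_expand[OF assms]) simp
  also have "\<dots> = (\<Sum>k\<le>n. cnj (coeff q k) * L2_inner M (monom 1 k) p)"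
    by (subst (2) L2_cnj) simp
  finally show ?thesis .
qed

text \<open>Reversal acts on the circle as conjugation followed by multiplication by
  \<open>z ^ n\<close>, so it reads the inner products with monomials from the top down.\<close>

lemma L2_star:
  assumes "k \<le> n"
  shows "L2_inner M (monom 1 k) (ropoly a n) = cnj (L2_inner M (monom 1 (n - k)) (opoly a n))"
proof -
  have "L2_inner M (monom 1 k) (ropoly a n) = L2_inner M (opoly a n) (monom 1 (n - k))"
    unfolding L2_inner_def
  proof (rule integral_cong_circle)
    fix z :: complex assume z: "cmod z = 1"
    have zz: "cnj z ^ k * z ^ k = 1"
      using circle_mult_cnj[OF z] by (simp add: power_mult_distrib[symmetric] mult.commute)
    have "cnj (poly (monom 1 k) z) * poly (ropoly a n) z
        = (cnj z ^ k * z ^ k) * (cnj (poly (opoly a n) z) * z ^ (n - k))"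
      using assms by (simp add: ropoly_circle[OF z] poly_monom power_add[symmetric] mult_ac)
    then show "cnj (poly (monom 1 k) z) * poly (ropoly a n) z
        = cnj (poly (opoly a n) z) * poly (monom 1 (n - k)) z"
      unfolding zz by (simp add: poly_monom)
  qed
  then show ?thesis by (subst L2_cnj[symmetric])
qed

lemma L2_self: "L2_inner M p p = of_real (\<integral>z. (cmod (poly p z))\<^sup>2 \<partial>M)"
  unfolding L2_inner_def integral_complex_of_real[symmetric]
  by (rule integral_cong_circle) (simp add: complex_norm_square mult.commute del: of_real_power)

text \<open>A condition on the single degree \<open>n\<close>. Given orthogonality to lower degrees
  and coefficients in the open disc, the second equation encodes unit norm; testing against
  monomials makes both equations easy to carry through the recursion.\<close>

definition orth_upto :: "(nat \<Rightarrow> complex) \<Rightarrow> nat \<Rightarrow> bool" where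
  "orth_upto a n \<longleftrightarrow> (\<forall>k<n. L2_inner M (monom 1 k) (opoly a n) = 0) \<and>
     L2_inner M (monom 1 n) (opoly a n) = of_real (rho_prod a n)"

lemma orth_degree_le:
  assumes "orth_upto a n" "degree q \<le> n"
  shows "L2_inner M q (opoly a n) = cnj (coeff q n) * of_real (rho_prod a n)"
proof -
  have "L2_inner M q (opoly a n) = (\<Sum>k\<le>n. cnj (coeff q k) * L2_inner M (monom 1 k) (opoly a n))"
    by (rule L2_expand_left) (use assms in auto)
  also have "\<dots> = (\<Sum>k\<in>{n}. cnj (coeff q k) * L2_inner M (monom 1 k) (opoly a n))"
    using assms(1) by (intro sum.mono_neutral_right) (auto simp: orth_upto_def)
  finally show ?thesis using assms(1) by (simp add: orth_upto_def)
qed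

lemma orth_norm:
  assumes "orth_upto a n" "\<And>k. k < n \<Longrightarrow> cmod (a k) < 1"
  shows "L2_inner M (opoly a n) (opoly a n) = 1"
  using orth_degree_le[OF assms(1) degree_opoly_le] rho_prod_pos[of n a] assms(2)
  by (simp add: coeff_opoly_top)

lemma orth_integral_norm:
  assumes "orth_upto a n" "\<And>k. k < n \<Longrightarrow> cmod (a k) < 1"
  shows "(\<integral>z. (cmod (poly (opoly a n) z))\<^sup>2 \<partial>M) = 1"
  using orth_norm[OF assms] L2_self[of "opoly a n"] by (metis of_real_eq_1_iff)

end

text \<open>The relations determine the moments one by one: the inner product of 1 with
  \<open>opoly a j\<close> is prescribed and its leading coefficient is nonzero, so the moment of
  order \<open>j\<close> is expressed through lower ones. The Gram matrix of the monomials is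
  Toeplitz and Hermitian, hence given by these moments.\<close>

lemma moments_unique:
  assumes "circle_measure M" "circle_measure M'"
    and "\<And>n. n \<le> N \<Longrightarrow> circle_measure.orth_upto M a n"
    and "\<And>n. n \<le> N \<Longrightarrow> circle_measure.orth_upto M' a n"
    and a: "\<And>k. k < N \<Longrightarrow> cmod (a k) < 1"
    and pq: "degree p \<le> N" "degree q \<le> N"
  shows "L2_inner M q p = L2_inner M' q p"
proof -
  interpret M: circle_measure M by fact
  interpret M': circle_measure M' by fact
  have mom: "j \<le> N \<Longrightarrow> L2_inner M 1 (monom 1 j) = L2_inner M' 1 (monom 1 j)" for j
  proof (induction j rule: less_induct)
    case (less j)
    have "L2_inner M 1 (opoly a j) = L2_inner M' 1 (opoly a j)"
      using M.orth_degree_le[OF assms(3)[OF less.prems], of 1] M'.orth_degree_le[OF assms(4)[OF less.prems], of 1]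
      by simp
    moreover have "L2_inner K 1 (opoly a j) = (\<Sum>k<j. coeff (opoly a j) k * L2_inner K 1 (monom 1 k))
        + of_real (1 / rho_prod a j) * L2_inner K 1 (monom 1 j)" if "circle_measure K" for K
      using circle_measure.L2_expand[OF that degree_opoly_le[of a j], of 1]
      by (simp add: lessThan_Suc_atMost[symmetric] coeff_opoly_top)
    moreover have "(\<Sum>k<j. coeff (opoly a j) k * L2_inner M 1 (monom 1 k))
        = (\<Sum>k<j. coeff (opoly a j) k * L2_inner M' 1 (monom 1 k))"
      using less by (intro sum.cong) auto
    moreover have "rho_prod a j > 0"
      using a less.prems by (intro rho_prod_pos) auto
    ultimately show ?case using assms(1,2) by simp
  qed
  have shift: "L2_inner K (monom 1 i) (monom 1 j) = L2_inner K 1 (monom 1 (j - i))"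
    if "circle_measure K" "i \<le> j" for K i j
    using that(2)
  proof (induction i arbitrary: j)
    case (Suc i)
    then obtain j' where "j = Suc j'" by (cases j) auto
    then show ?case
      using Suc circle_measure.L2_monom_shift[OF that(1), of i "monom 1 j'"] by (simp add: monom_Suc)
  qed (simp add: one_pCons monom_0)
  have ij: "L2_inner M (monom 1 i) (monom 1 j) = L2_inner M' (monom 1 i) (monom 1 j)" if "i \<le> N" "j \<le> N" for i j
  proof (cases "i \<le> j")
    case True
    then show ?thesis using shift[OF assms(1) True] shift[OF assms(2) True] mom[of "j - i"] that by simp
  next
    case False
    then have "j \<le> i" by simp
    then show ?thesis
      using shift[OF assms(1) \<open>j \<le> i\<close>] shift[OF assms(2) \<open>j \<le> i\<close>] mom[of "i - j"] that
        M.L2_cnj[of "monom 1 i" "monom 1 j"] M'.L2_cnj[of "monom 1 i" "monom 1 j"] by simp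
  qed
  show ?thesis
    unfolding M.L2_expand[OF pq(1)] M'.L2_expand[OF pq(1)] M.L2_expand_left[OF pq(2)] M'.L2_expand_left[OF pq(2)]
    using ij by simp
qed

section \<open>Bernstein-Szego measures\<close>

definition bernstein_szego :: "(nat \<Rightarrow> complex) \<Rightarrow> nat \<Rightarrow> complex measure" where
  "bernstein_szego a n = density dtheta_circle (\<lambda>z. ennreal (1 / (cmod (poly (opoly a n) z))\<^sup>2))"

lemma borel_measurable_poly [measurable]: "poly p \<in> borel_measurable (borel :: complex measure)"
  by (intro borel_measurable_continuous_onI continuous_intros)

lemma integral_bernstein_szego:
  fixes g :: "complex \<Rightarrow> 'b::{banach, second_countable_topology}"
  assumes [measurable]: "g \<in> borel_measurable circle_borel"
  shows "integral\<^sup>L (bernstein_szego a n) g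
     = (\<integral>z. (1 / (cmod (poly (opoly a n) z))\<^sup>2) *\<^sub>R g z \<partial>dtheta_circle)"
  unfolding bernstein_szego_def by (rule integral_density) auto

lemma circle_measure_bernstein_szego:
  assumes a: "\<And>k. cmod (a k) < 1"
  shows "circle_measure (bernstein_szego a n)"
proof -
  have "continuous_on (sphere 0 1) (\<lambda>z. 1 / (cmod (poly (opoly a n) z))\<^sup>2)"
    using opoly_circle_nz[OF a] by (intro continuous_intros) auto
  then have "compact ((\<lambda>z. 1 / (cmod (poly (opoly a n) z))\<^sup>2) ` sphere 0 1)"
    by (intro compact_continuous_image) auto
  then obtain B where B: "\<forall>x\<in>sphere 0 1. norm (1 / (cmod (poly (opoly a n) x))\<^sup>2) \<le> B"
    unfolding bounded_iff by (auto dest!: compact_imp_bounded simp: bounded_iff)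
  have "emeasure (bernstein_szego a n) (sphere 0 1)
      = (\<integral>\<^sup>+z. ennreal (1 / (cmod (poly (opoly a n) z))\<^sup>2) * indicator (sphere 0 1) z \<partial>dtheta_circle)"
    unfolding bernstein_szego_def
    by (subst emeasure_density) (auto intro: sets.top[of circle_borel, simplified])
  also have "\<dots> \<le> (\<integral>\<^sup>+z. ennreal B \<partial>dtheta_circle)"
    using B by (intro nn_integral_mono) (auto simp: ennreal_leI split: split_indicator)
  also have "\<dots> < \<infinity>"
    by (simp add: dtheta_circle.emeasure_space_1[simplified])
  finally have "finite_measure (bernstein_szego a n)"
    by (intro finite_measureI) (simp add: bernstein_szego_def)
  then show ?thesis
    unfolding circle_measure_def circle_measure_axioms_def by (simp add: bernstein_szego_def)
qed

lemma orth_upto_bernstein_szego: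
  assumes a: "\<And>k. cmod (a k) < 1" and nN: "n \<le> N"
  shows "circle_measure.orth_upto (bernstein_szego a N) a n"
proof -
  interpret circle_measure "bernstein_szego a N"
    using a by (rule circle_measure_bernstein_szego)
  \<comment> \<open>On the circle \<open>cnj (z\<^sup>k) \<phi>\<^sub>N / \<bar>\<phi>\<^sub>N\<bar>\<^sup>2 = z\<^bsup>N-k\<^esup> / \<phi>\<^sub>N\<^sup>*\<close>, which is holomorphic on the disc. The lower
    degrees follow by running the Szego recursion backwards.\<close>
  have top: "L2_inner (bernstein_szego a N) (monom 1 k) (opoly a N) = (if k = N then of_real (rho_prod a N) else 0)"
    if "k \<le> N" for k
  proof -
    let ?g = "\<lambda>z. z ^ (N - k) / poly (ropoly a N) z"
    have "L2_inner (bernstein_szego a N) (monom 1 k) (opoly a N) = integral\<^sup>L dtheta_circle ?g"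
      unfolding L2_inner_def
    proof (subst integral_bernstein_szego)
      show "(\<integral>z. (1 / (cmod (poly (opoly a N) z))\<^sup>2) *\<^sub>R (cnj (poly (monom 1 k) z) * poly (opoly a N) z) \<partial>dtheta_circle)
        = integral\<^sup>L dtheta_circle ?g"
      proof (rule Bochner_Integration.integral_cong)
        fix z assume "z \<in> space dtheta_circle"
        then have z: "cmod z = 1" by simp
        have zz: "cnj z ^ k * z ^ k = 1"
          using circle_mult_cnj[OF z] by (simp add: power_mult_distrib[symmetric] mult.commute)
        let ?p = "poly (opoly a N) z"
        have p: "?p \<noteq> 0" using opoly_circle_nz[of a z N] a z by auto
        have z0: "z \<noteq> 0" using z by auto
        have "(1 / (cmod ?p)\<^sup>2) *\<^sub>R (cnj (poly (monom 1 k) z) * ?p) = cnj z ^ k * ?p / (?p * cnj ?p)"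
          by (simp add: poly_monom scaleR_conv_of_real complex_norm_square del: of_real_power)
        also have "\<dots> = cnj z ^ k / cnj ?p" using p by simp
        also have "\<dots> = (cnj z ^ k * z ^ k) * z ^ (N - k) / (z ^ N * cnj ?p)"
          using that z0 by (simp add: mult.assoc power_add[symmetric])
        finally show "(1 / (cmod ?p)\<^sup>2) *\<^sub>R (cnj (poly (monom 1 k) z) * ?p) = ?g z"
          unfolding zz ropoly_circle[OF z] by simp
      qed simp
    qed (intro borel_measurable_circle_continuous continuous_intros)
    also have "\<dots> = ?g 0"
      using ropoly_nz[OF a] by (intro mean_value_circle) (auto intro!: holomorphic_intros continuous_intros)
    finally show ?thesis
      using that rho_prod_pos[of N a] a by (auto simp: poly_ropoly_0)
  qed
  show ?thesis using nN
  proof (induction rule: inc_induct)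
    case base
    then show ?case using top by (simp add: orth_upto_def)
  next
    case (step n)
    let ?I = "L2_inner (bernstein_szego a N)"
    let ?r = "of_real (rho (a n)) :: complex"
    have r: "?r \<noteq> 0" using rho_pos[OF a[of n]] by simp
    have r2: "?r * ?r = 1 - a n * cnj (a n)" using a by (rule rho_mult_self)
    have "smult ?r (opoly a (Suc n)) + smult (cnj (a n) * ?r) (ropoly a (Suc n))
        = (pCons 0 (opoly a n) - smult (cnj (a n)) (ropoly a n))
          + smult (cnj (a n)) (ropoly a n - smult (a n) (pCons 0 (opoly a n)))"
      using r by (simp add: field_simps)
    also have "\<dots> = smult (?r * ?r) (pCons 0 (opoly a n))"
      unfolding r2 by (simp add: smult_diff_right smult_diff_left mult.commute)
    finally have inv: "smult (?r * ?r) (pCons 0 (opoly a n))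
        = smult ?r (opoly a (Suc n)) + smult (cnj (a n) * ?r) (ropoly a (Suc n))" by simp
    have "?r * ?r * ?I (monom 1 k) (opoly a n)
        = ?r * ?I (monom 1 (Suc k)) (opoly a (Suc n))" if "k \<le> n" for k
    proof -
      have "?r * ?r * ?I (monom 1 k) (opoly a n) = ?I (monom 1 (Suc k)) (smult (?r * ?r) (pCons 0 (opoly a n)))"
        by (simp only: L2_smult L2_monom_shift)
      also have "\<dots> = ?r * ?I (monom 1 (Suc k)) (opoly a (Suc n))
          + cnj (a n) * ?r * ?I (monom 1 (Suc k)) (ropoly a (Suc n))"
        unfolding inv by (simp only: L2_add L2_smult)
      \<comment> \<open>By \<open>L2_star\<close> this is the conjugate of an inner product of
        \<open>opoly a (Suc n)\<close> with the monomial of degree \<open>n - k\<close>, which is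
        below \<open>Suc n\<close>.\<close>
      also have "?I (monom 1 (Suc k)) (ropoly a (Suc n)) = 0"
        using step.IH that by (subst L2_star) (auto simp: orth_upto_def simp del: opoly.simps)
      finally show ?thesis by simp
    qed
    then have *: "?r * ?I (monom 1 k) (opoly a n) = ?I (monom 1 (Suc k)) (opoly a (Suc n))" if "k \<le> n" for k
      using that r unfolding mult.assoc mult_cancel_left by blast
    have "?I (monom 1 k) (opoly a n) = 0" if "k < n" for k
      using *[of k] that r step.IH by (simp add: orth_upto_def del: opoly.simps)
    moreover have "?I (monom 1 n) (opoly a n) = of_real (rho_prod a n)"
      using *[of n] r step.IH by (simp add: orth_upto_def rho_prod_Suc mult.commute del: opoly.simps)
    ultimately show ?case by (simp add: orth_upto_def)
  qed
qed

section \<open>Verblunsky coefficients of a measure as recursion coefficients\<close>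

context circle_measure
begin

lemma L2_diff_left: "L2_inner M (q - q') p = L2_inner M q p - L2_inner M q' p"
  using L2_diff[of p q q'] by (metis L2_cnj complex_cnj_diff)

lemma L2_smult_left: "L2_inner M (smult c q) p = cnj c * L2_inner M q p"
  using L2_smult[of p c q] by (metis L2_cnj complex_cnj_mult)

lemma L2_ropoly_self: "L2_inner M (ropoly a n) (ropoly a n) = L2_inner M (opoly a n) (opoly a n)"
proof -
  have "(\<integral>z. (cmod (poly (ropoly a n) z))\<^sup>2 \<partial>M) = (\<integral>z. (cmod (poly (opoly a n) z))\<^sup>2 \<partial>M)"
    by (rule integral_cong_circle) (simp add: norm_ropoly_circle)
  then show ?thesis by (simp only: L2_self)
qed

lemma finite_combination_of_deltasI:
  assumes "finite Z" "Z \<subseteq> sphere 0 1" "measure M (sphere 0 1 - Z) = 0"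
  shows "finite_combination_of_deltas M"
  unfolding finite_combination_of_deltas_def
proof (intro exI conjI ballI)
  show "finite Z" by fact
  fix A assume A: "A \<in> sets M"
  have sing: "{z} \<in> sets M" if "z \<in> Z" for z
  proof -
    have "{z} = sphere 0 1 \<inter> {z}" using that assms(2) by auto
    then have "{z} \<in> sets circle_borel"
      unfolding circle_borel_def sets_restrict_space by (metis borel_singleton image_eqI sets.empty_sets)
    then show ?thesis using sets_M by simp
  qed
  have Z: "Z \<in> sets M"
    using sets.finite_UN[of Z "\<lambda>z. {z}" M] assms(1) sing by simp
  have "sphere 0 1 \<in> sets M"
    using sets.top[of M] by (simp add: space_M)
  then have N: "sphere 0 1 - Z \<in> null_sets M"
    using Z assms(3) by (auto simp: null_sets_def emeasure_eq_measure)
  have "A \<subseteq> sphere 0 1" using sets.sets_into_space[OF A] by (simp add: space_M)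
  then have "A = (A \<inter> Z) \<union> (A \<inter> (sphere 0 1 - Z))" by auto
  moreover have "measure M ((A \<inter> Z) \<union> (A \<inter> (sphere 0 1 - Z))) = measure M (A \<inter> Z)"
    using A Z null_set_Int1[OF N A] by (intro measure_Un_null_set) auto
  ultimately have "measure M A = measure M (A \<inter> Z)" by simp
  also have "\<dots> = (\<Sum>z\<in>A \<inter> Z. measure M {z})"
    using assms(1) sing by (intro finite_measure_eq_sum_singleton) auto
  also have "\<dots> = (\<Sum>z\<in>Z. measure M {z} * indicator A z)"
    using assms(1) by (simp add: indicator_def if_distrib sum.inter_filter[symmetric] Int_def conj_commute cong: if_cong)
  finally show "measure M A = (\<Sum>z\<in>Z. measure M {z} * indicator A z)" .
qed

text \<open>A polynomial of norm zero vanishes almost everywhere, which concentrates the measure on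
  its finitely many roots.\<close>

lemma L2_self_pos:
  assumes "\<not> finite_combination_of_deltas M" "p \<noteq> 0"
  shows "(\<integral>z. (cmod (poly p z))\<^sup>2 \<partial>M) > 0"
proof (rule ccontr)
  assume "\<not> ?thesis"
  then have "(\<integral>z. (cmod (poly p z))\<^sup>2 \<partial>M) = 0"
    by (simp add: not_less antisym)
  then have "AE z in M. (cmod (poly p z))\<^sup>2 = 0"
    by (subst (asm) integral_nonneg_eq_0_iff_AE) (auto intro!: integrable_continuous continuous_intros)
  then have ae: "AE z in M. poly p z = 0" by simp
  have "emeasure M {z \<in> space M. poly p z \<noteq> 0} = 0"
    using ae by (subst (asm) AE_iff_measurable[OF _ refl]) auto
  moreover have "{z \<in> space M. poly p z \<noteq> 0} = sphere 0 1 - {z. poly p z = 0} \<inter> sphere 0 1"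
    by (auto simp: space_M)
  ultimately have "finite_combination_of_deltas M"
    using poly_roots_finite[OF assms(2)]
    by (intro finite_combination_of_deltasI[of "{z. poly p z = 0} \<inter> sphere 0 1"]) (auto simp: measure_def)
  then show False using assms(1) by simp
qed

text \<open>Resolves the definite description: the difference of two candidates has degree below
  \<open>n\<close>, so it is orthogonal to itself and vanishes by
  \<open>L2_self_pos\<close>.\<close>

lemma monic_OP_eqI:
  assumes nt: "\<not> finite_combination_of_deltas M"
    and P: "degree P = n" "lead_coeff P = 1" "\<And>k. k < n \<Longrightarrow> L2_inner M (monom 1 k) P = 0"
  shows "monic_OP M n = P"
  unfolding monic_OP_def
proof (rule the_equality)
  have orth: "L2_inner M q P = 0" if dq: "degree q < n" for q
  proof -
    obtain m where n: "n = Suc m" using dq by (cases n) auto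
    have "L2_inner M q P = (\<Sum>k\<le>m. cnj (coeff q k) * L2_inner M (monom 1 k) P)"
      by (rule L2_expand_left) (use dq n in auto)
    then show ?thesis using P(3) n by simp
  qed
  then show "degree P = n \<and> lead_coeff P = 1 \<and> (\<forall>q. degree q < n \<longrightarrow> L2_inner M q P = 0)"
    using P by blast
  fix p assume p: "degree p = n \<and> lead_coeff p = 1 \<and> (\<forall>q. degree q < n \<longrightarrow> L2_inner M q p = 0)"
  show "p = P"
  proof (rule ccontr)
    assume ne: "p \<noteq> P"
    have "coeff p n = 1" "coeff P n = 1" using p P by auto
    then have "coeff (p - P) n = 0" by simp
    moreover have "degree (p - P) \<le> n" using p P degree_diff_le_max[of p P] by simp
    ultimately have deg: "degree (p - P) < n"
      using ne by (metis eq_iff_diff_eq_0 leading_coeff_0_iff order_less_le)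
    have "L2_inner M (p - P) (p - P) = 0"
      using p orth deg by (simp add: L2_diff)
    then show False
      using L2_self_pos[OF nt, of "p - P"] ne unfolding L2_self by simp
  qed
qed

end

lemma circle_measure_nontrivial:
  "nontrivial_prob_on_circle \<nu> \<Longrightarrow> circle_measure \<nu>"
  unfolding nontrivial_prob_on_circle_def circle_measure_def circle_measure_axioms_def
  by (simp add: prob_space.finite_measure)

text \<open>A Gram-Schmidt step: \<open>Q\<close> is orthogonal to all degrees up to
  \<open>n\<close>, so \<open>K\<close> times \<open>Q\<close> is the next monic orthogonal
  polynomial. Its value at 0 identifies \<open>a\<close> as the Verblunsky coefficient, and the
  positive norm \<open>1 - a * cnj a\<close> of \<open>Q\<close> puts \<open>a\<close> in the disc.
  The bound on earlier coefficients is needed for \<open>K > 0\<close>, hence the joint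
  induction.\<close>

lemma orth_upto_verblunsky_aux:
  assumes "nontrivial_prob_on_circle \<nu>"
  shows "circle_measure.orth_upto \<nu> (verblunsky \<nu>) n \<and> (\<forall>k<n. cmod (verblunsky \<nu> k) < 1)"
proof -
  interpret circle_measure \<nu> using assms by (rule circle_measure_nontrivial)
  interpret prob_space \<nu> using assms by (simp add: nontrivial_prob_on_circle_def)
  have nt: "\<not> finite_combination_of_deltas \<nu>"
    using assms by (simp add: nontrivial_prob_on_circle_def)
  let ?b = "verblunsky \<nu>" and ?I = "L2_inner \<nu>"
  show ?thesis
  proof (induction n)
    case 0
    show ?case
      by (simp add: orth_upto_def rho_prod_def L2_inner_def prob_space)
  next
    case (Suc n)
    then have orth: "orth_upto ?b n" and b: "\<And>k. k < n \<Longrightarrow> cmod (?b k) < 1" by auto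
    define K where "K = rho_prod ?b n"
    have K: "K > 0" unfolding K_def using b by (rule rho_prod_pos)
    define p where "p = opoly ?b n"
    define q where "q = ropoly ?b n"
    \<comment> \<open>Chosen to make \<open>Q\<close> orthogonal to constants, given that the inner
      product of 1 with \<open>q\<close> is \<open>K\<close>. Orthogonality to the higher powers is
      inherited from \<open>p\<close> and \<open>q\<close>.\<close>
    define a where "a = cnj (?I 1 (pCons 0 p) / of_real K)"
    define Q where "Q = pCons 0 p - smult (cnj a) q"
    have p_orth: "\<And>k. k < n \<Longrightarrow> ?I (monom 1 k) p = 0" and p_top: "?I (monom 1 n) p = of_real K"
      using orth unfolding orth_upto_def p_def K_def by auto
    have q_star: "?I (monom 1 k) q = cnj (?I (monom 1 (n - k)) p)" if "k \<le> n" for k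
      unfolding p_def q_def by (rule L2_star[OF that])
    have Q_orth: "?I (monom 1 k) Q = 0" if "k \<le> n" for k
    proof (cases k)
      case 0
      have "?I 1 q = of_real K"
        using q_star[of 0] p_top by (simp add: monom_0 one_pCons)
      then show ?thesis
        using K 0 by (simp add: Q_def L2_diff L2_smult a_def monom_0 one_pCons)
    next
      case (Suc k')
      then show ?thesis
        using q_star[of k] p_orth[of k'] p_orth[of "n - k"] that
        by (simp add: Q_def L2_diff L2_smult L2_monom_shift)
    qed
    have deg_p: "degree p \<le> n" and deg_q: "degree q \<le> n"
      by (simp_all add: p_def q_def degree_opoly_le degree_ropoly_le)
    have coQ: "coeff Q (Suc n) = of_real (1 / K)"
      using deg_q by (simp add: Q_def coeff_eq_0 p_def K_def coeff_opoly_top)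
    have "degree Q \<le> Suc n"
      unfolding Q_def using deg_p deg_q
      by (intro degree_diff_le) (auto intro: order_trans[OF degree_pCons_le] order_trans[OF degree_smult_le])
    then have deg_Q: "degree Q = Suc n"
      using coQ K by (intro antisym le_degree) auto
    have "monic_OP \<nu> (Suc n) = smult (of_real K) Q"
      using K deg_Q coQ Q_orth by (intro monic_OP_eqI[OF nt]) (auto simp: L2_smult)
    moreover have "poly q 0 = of_real (1 / K)"
      unfolding q_def K_def by (rule poly_ropoly_0)
    ultimately have ba: "?b n = a"
      using K by (simp add: verblunsky_def Q_def)
    have QQ: "?I Q Q = 1 - a * cnj a"
    proof -
      have pp: "?I p p = 1" unfolding p_def using orth b by (rule orth_norm)
      then have qq: "?I q q = 1" unfolding p_def q_def by (simp add: L2_ropoly_self)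
      have "?I q Q = (\<Sum>k\<le>n. cnj (coeff q k) * ?I (monom 1 k) Q)"
        by (rule L2_expand_left[OF deg_q])
      then have qQ: "?I q Q = 0" using Q_orth by simp
      then have "?I q (pCons 0 p) = cnj a"
        using qq by (simp add: Q_def L2_diff L2_smult)
      then have "?I (pCons 0 p) q = a" using L2_cnj[of "pCons 0 p" q] by simp
      moreover have "?I Q Q = ?I (pCons 0 p) Q"
        using qQ by (subst Q_def) (simp add: L2_diff_left L2_smult_left)
      ultimately show ?thesis
        using pp by (simp add: Q_def L2_diff L2_smult L2_pCons)
    qed
    have "Q \<noteq> 0" using deg_Q by auto
    then have "(\<integral>z. (cmod (poly Q z))\<^sup>2 \<partial>\<nu>) > 0" by (rule L2_self_pos[OF nt])
    moreover have "complex_of_real (\<integral>z. (cmod (poly Q z))\<^sup>2 \<partial>\<nu>) = complex_of_real (1 - (cmod a)\<^sup>2)"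
      using QQ unfolding L2_self by (simp add: complex_norm_square del: of_real_power)
    ultimately have "(cmod a)\<^sup>2 < 1" unfolding of_real_eq_iff by simp
    then have a1: "cmod a < 1" by (simp add: abs_square_less_1)
    have r2: "of_real (rho a) * of_real (rho a) = 1 - a * cnj a" using a1 by (rule rho_mult_self)
    \<comment> \<open>Only the top coefficient \<open>1 / K\<close> of \<open>Q\<close> survives, so
      the inner product with the top monomial is \<open>K\<close> times the squared norm.\<close>
    have "?I Q Q = (\<Sum>k\<le>Suc n. cnj (coeff Q k) * ?I (monom 1 k) Q)"
      by (rule L2_expand_left) (simp add: deg_Q)
    also have "\<dots> = cnj (coeff Q (Suc n)) * ?I (monom 1 (Suc n)) Q"
      using Q_orth by simp
    finally have top: "?I (monom 1 (Suc n)) Q = of_real K * (of_real (rho a) * of_real (rho a))"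
      using K unfolding QQ r2 coQ by (simp add: field_simps)
    have op: "opoly ?b (Suc n) = smult (of_real (1 / rho a)) Q"
      by (simp add: Q_def p_def q_def ba)
    have "?I (monom 1 k) (opoly ?b (Suc n)) = 0" if "k < Suc n" for k
      unfolding op L2_smult using Q_orth that by simp
    moreover have "?I (monom 1 (Suc n)) (opoly ?b (Suc n)) = of_real (rho_prod ?b (Suc n))"
      unfolding op L2_smult top using rho_pos[OF a1] by (simp add: rho_prod_Suc ba K_def)
    ultimately have "orth_upto ?b (Suc n)" by (simp add: orth_upto_def)
    then show ?case using b ba a1 by (auto simp: less_Suc_eq)
  qed
qed

lemma orth_upto_verblunsky:
  "nontrivial_prob_on_circle \<nu> \<Longrightarrow> circle_measure.orth_upto \<nu> (verblunsky \<nu>) n"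
  using orth_upto_verblunsky_aux by blast

lemma norm_verblunsky_less_1:
  "nontrivial_prob_on_circle \<nu> \<Longrightarrow> cmod (verblunsky \<nu> k) < 1"
  using orth_upto_verblunsky_aux[of \<nu> "Suc k"] by blast

section \<open>Weak convergence on compact null sets\<close>

text \<open>On the circle a real polynomial is a Laurent polynomial. Factoring out the negative
  powers turns its integral into an \<open>L2_inner\<close> of two polynomials, to which
  \<open>moments_unique\<close> applies.\<close>

lemma real_polynomial_function_circle:
  assumes "real_polynomial_function g"
  shows "\<exists>p m. \<forall>z. cmod z = 1 \<longrightarrow> complex_of_real (g z) = cnj (poly (monom 1 m) z) * poly p z"
  using assms
proof (induction rule: real_polynomial_function.induct)
  case (linear f)
  \<comment> \<open>From \<open>Re z = (z + cnj z) / 2\<close> and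
    \<open>Im z = (z - cnj z) / (2 * \<i>)\<close>.\<close>
  define A where "A = complex_of_real (f 1) / 2 + complex_of_real (f \<i>) / (2 * \<i>)"
  define B where "B = complex_of_real (f 1) / 2 - complex_of_real (f \<i>) / (2 * \<i>)"
  show ?case
  proof (intro exI allI impI)
    fix z :: complex assume z: "cmod z = 1"
    have "f z = f (Re z *\<^sub>R 1 + Im z *\<^sub>R \<i>)"
      by (rule arg_cong[of _ _ f]) (simp add: complex_eq_iff)
    also have "\<dots> = Re z * f 1 + Im z * f \<i>"
      using linear by (simp add: linear_simps)
    finally have "complex_of_real (f z) = z * A + cnj z * B"
      by (simp add: A_def B_def complex_eq_iff field_simps)
    also have "\<dots> = (z * cnj z) * (z * A) + cnj z * B"
      using circle_mult_cnj[OF z] by simp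
    finally show "complex_of_real (f z) = cnj (poly (monom 1 1) z) * poly [:B, 0, A:] z"
      by (simp add: poly_monom algebra_simps)
  qed
next
  case (const c)
  show ?case
    by (intro exI[of _ "[:complex_of_real c:]"] exI[of _ 0]) (simp add: poly_monom)
next
  case (add f g)
  then obtain p m q k where
    f: "\<And>z. cmod z = 1 \<Longrightarrow> complex_of_real (f z) = cnj (poly (monom 1 m) z) * poly p z" and
    g: "\<And>z. cmod z = 1 \<Longrightarrow> complex_of_real (g z) = cnj (poly (monom 1 k) z) * poly q z"
    by blast
  show ?case
  proof (intro exI allI impI)
    fix z :: complex assume z: "cmod z = 1"
    have zz: "z ^ j * cnj z ^ j = 1" for j
      using circle_mult_cnj[OF z] by (simp add: power_mult_distrib[symmetric])
    have "complex_of_real (f z + g z)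
        = cnj z ^ m * (z ^ k * cnj z ^ k) * poly p z + cnj z ^ k * (z ^ m * cnj z ^ m) * poly q z"
      unfolding zz by (simp add: f[OF z] g[OF z] poly_monom)
    then show "complex_of_real (f z + g z)
        = cnj (poly (monom 1 (m + k)) z) * poly (monom 1 k * p + monom 1 m * q) z"
      by (simp add: poly_monom power_add algebra_simps)
  qed
next
  case (mult f g)
  then obtain p m q k where
    f: "\<And>z. cmod z = 1 \<Longrightarrow> complex_of_real (f z) = cnj (poly (monom 1 m) z) * poly p z" and
    g: "\<And>z. cmod z = 1 \<Longrightarrow> complex_of_real (g z) = cnj (poly (monom 1 k) z) * poly q z"
    by blast
  show ?case
    by (intro exI[of _ "p * q"] exI[of _ "m + k"]) (simp add: f g poly_monom power_add)
qed

text \<open>The total mass is the normalisation at degree 0, where \<open>rho_prod\<close> is an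
  empty product.\<close>

lemma prob_space_bernstein_szego:
  assumes a: "\<And>k. cmod (a k) < 1"
  shows "prob_space (bernstein_szego a n)"
proof -
  interpret circle_measure "bernstein_szego a n"
    using a by (rule circle_measure_bernstein_szego)
  have "L2_inner (bernstein_szego a n) (monom 1 0) (opoly a 0) = 1"
    using orth_upto_bernstein_szego[of a 0 n, OF a] by (simp add: orth_upto_def rho_prod_def)
  then have "measure (bernstein_szego a n) (space (bernstein_szego a n)) = 1"
    by (simp add: L2_inner_def poly_monom scaleR_conv_of_real)
  then show ?thesis by (intro prob_spaceI) (simp add: emeasure_eq_measure)
qed

text \<open>A continuous majorant of the indicator of \<open>C\<close> with small
  \<open>\<nu>\<close>-integral is approximated uniformly by a Laurent polynomial, whose integrals
  under both measures agree for large \<open>n\<close>. The majorant and the two uses of the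
  approximation cost \<open>e / 3\<close> each.\<close>

lemma bernstein_szego_compact_null:
  assumes nt: "nontrivial_prob_on_circle \<nu>"
    and C: "compact C" "C \<subseteq> sphere 0 1" "measure \<nu> C = 0" and e: "e > 0"
  shows "\<forall>\<^sub>F n in sequentially. measure (bernstein_szego (verblunsky \<nu>) n) C \<le> e"
\<comment> \<open>The empty set is separate because \<open>infdist\<close> to it is 0 by
  convention.\<close>
proof (cases "C = {}")
  case False
  interpret N: circle_measure \<nu> using nt by (rule circle_measure_nontrivial)
  interpret N: prob_space \<nu> using nt by (simp add: nontrivial_prob_on_circle_def)
  let ?b = "verblunsky \<nu>"
  have b: "\<And>k. cmod (?b k) < 1" using nt by (rule norm_verblunsky_less_1)
  have C_circle: "C \<in> sets circle_borel"
    using C(1,2) by (rule compact_sets_circle_borel)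
  \<comment> \<open>Powers of a continuous function that is 1 on \<open>C\<close> and below 1
    elsewhere, so they decrease to the indicator.\<close>
  define h where "h k z = (1 / (1 + infdist z C)) ^ k" for k :: nat and z :: complex
  have h_cont: "continuous_on S (h k)" for k S
    unfolding h_def using infdist_nonneg[of _ C]
    by (intro continuous_intros) (metis add_nonneg_eq_0_iff zero_le_one zero_neq_one)
  have h_range: "0 \<le> h k z \<and> h k z \<le> 1" for k z
    unfolding h_def by (auto intro!: power_le_one simp: infdist_nonneg divide_le_eq)
  have h_C: "h k z = 1" if "z \<in> C" for k z
    using that by (simp add: h_def)
  have "(\<lambda>k. \<integral>z. h k z \<partial>\<nu>) \<longlonglongrightarrow> (\<integral>z. indicator C z \<partial>\<nu>)"
  proof (rule integral_dominated_convergence[where w = "\<lambda>_. 1"])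
    show "AE z in \<nu>. (\<lambda>k. h k z) \<longlonglongrightarrow> indicator C z"
    proof (rule AE_I2)
      fix z
      show "(\<lambda>k. h k z) \<longlonglongrightarrow> indicator C z"
      proof (cases "z \<in> C")
        case True
        then show ?thesis by (simp add: h_C)
      next
        case z: False
        then have "infdist z C > 0"
          using in_closed_iff_infdist_zero[OF compact_imp_closed[OF C(1)] \<open>C \<noteq> {}\<close>, of z] infdist_nonneg[of z C]
          by linarith
        then have "(\<lambda>k. (1 / (1 + infdist z C)) ^ k) \<longlonglongrightarrow> 0"
          by (intro LIMSEQ_realpow_zero) auto
        then show ?thesis using z by (simp add: h_def)
      qed
    qed
    show "h k \<in> borel_measurable \<nu>" for k
      using N.integrable_continuous[OF h_cont, of k] by simp
    show "AE z in \<nu>. norm (h k z) \<le> 1" for k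
      using h_range by auto
  qed (use C_circle N.sets_M in auto)
  also have "(\<integral>z. indicator C z \<partial>\<nu>) = (0 :: real)"
    using C_circle N.sets_M C(3) by (simp add: N.space_M Int_absorb2[OF C(2)])
  finally have "\<forall>\<^sub>F k in sequentially. (\<integral>z. h k z \<partial>\<nu>) < e / 3"
    by (rule order_tendstoD) (use e in simp)
  then obtain k where k: "(\<integral>z. h k z \<partial>\<nu>) < e / 3"
    by (auto dest: eventually_happens)
  obtain g where g: "real_polynomial_function g" and gh: "\<And>z. z \<in> sphere 0 1 \<Longrightarrow> \<bar>h k z - g z\<bar> < e / 3"
    using Stone_Weierstrass_real_polynomial_function[of "sphere 0 1" "h k" "e / 3"] h_cont e by auto
  have gh': "h k z \<le> g z + e / 3" "g z \<le> h k z + e / 3" if "z \<in> sphere 0 1" for z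
    using gh[OF that] unfolding abs_less_iff by linarith+
  have g_cont: "continuous_on S g" for S
    using continuous_on_polymonial_function[of g] g by (auto simp: real_polynomial_function_eq)
  obtain p m where pm: "\<And>z. cmod z = 1 \<Longrightarrow> complex_of_real (g z) = cnj (poly (monom 1 m) z) * poly p z"
    using real_polynomial_function_circle[OF g] by blast
  show ?thesis
  \<comment> \<open>From here on both factors of the Laurent polynomial have degree at most
    \<open>n\<close>, as \<open>moments_unique\<close> requires.\<close>
  proof (rule eventually_sequentiallyI[of "max m (degree p)"])
    fix n assume n: "max m (degree p) \<le> n"
    let ?B = "bernstein_szego ?b n"
    interpret B: circle_measure ?B using b by (rule circle_measure_bernstein_szego)
    interpret B: prob_space ?B using b by (rule prob_space_bernstein_szego)
    have int: "integrable ?B (h k)" "integrable ?B g" "integrable \<nu> (h k)" "integrable \<nu> g"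
      by (intro B.integrable_continuous N.integrable_continuous h_cont g_cont)+
    have "L2_inner ?B (monom 1 m) p = L2_inner \<nu> (monom 1 m) p"
    proof (rule moments_unique[where N = n and a = ?b])
      show "circle_measure \<nu>" by unfold_locales
      show "circle_measure ?B" by unfold_locales
      show "B.orth_upto ?b i" if "i \<le> n" for i
        using b that by (rule orth_upto_bernstein_szego)
      show "N.orth_upto ?b i" for i
        using nt by (rule orth_upto_verblunsky)
    qed (use n b in \<open>auto simp: degree_monom_eq\<close>)
    moreover have "L2_inner ?B (monom 1 m) p = of_real (\<integral>z. g z \<partial>?B)"
      unfolding L2_inner_def integral_complex_of_real[symmetric] by (rule B.integral_cong_circle) (simp add: pm)
    moreover have "L2_inner \<nu> (monom 1 m) p = of_real (\<integral>z. g z \<partial>\<nu>)"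
      unfolding L2_inner_def integral_complex_of_real[symmetric] by (rule N.integral_cong_circle) (simp add: pm)
    ultimately have eq: "(\<integral>z. g z \<partial>?B) = (\<integral>z. g z \<partial>\<nu>)" by simp
    have "measure ?B C = (\<integral>z. indicator C z \<partial>?B)"
      using C by (simp add: B.space_M Int_absorb2[OF C(2)])
    also have "\<dots> \<le> (\<integral>z. h k z \<partial>?B)"
    proof (rule integral_mono)
      show "integrable ?B (indicator C :: complex \<Rightarrow> real)"
        using C_circle B.sets_M by (intro integrable_real_indicator) (auto simp: B.emeasure_eq_measure)
      show "indicator C z \<le> h k z" for z
        using h_range[of k z] h_C[of z k] by (simp split: split_indicator)
    qed (rule int)
    also have "\<dots> \<le> (\<integral>z. g z + e / 3 \<partial>?B)"
    proof (rule integral_mono)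
      show "h k z \<le> g z + e / 3" if "z \<in> space ?B" for z
        using gh'(1) that unfolding B.space_M .
    qed (use int in simp_all)
    also have "\<dots> = (\<integral>z. g z \<partial>\<nu>) + e / 3"
      using int eq B.prob_space by simp
    also have "(\<integral>z. g z \<partial>\<nu>) \<le> (\<integral>z. h k z + e / 3 \<partial>\<nu>)"
    proof (rule integral_mono)
      show "g z \<le> h k z + e / 3" if "z \<in> space \<nu>" for z
        using gh'(2) that unfolding N.space_M .
    qed (use int in simp_all)
    also have "\<dots> = (\<integral>z. h k z \<partial>\<nu>) + e / 3"
      using int N.prob_space by simp
    finally show "measure ?B C \<le> e" using k by simp
  qed
qed (use e in simp)

subsection \<open>Perturbation of the transfer matrices\<close>

text \<open>One factor \<open>r\<close> comes from dividing the difference of squares by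
  \<open>A + B\<close>, the other two from the common denominator \<open>A * B\<close>. Unimodular
  \<open>l\<close> leaves the modulus of \<open>\<alpha>\<close> unchanged.\<close>

lemma inverse_rho_diff:
  assumes "cmod \<alpha> < 1" "cmod \<beta> < 1" "rho \<alpha> \<ge> r" "rho \<beta> \<ge> r" "r > 0" "cmod l = 1"
  shows "\<bar>1 / rho \<beta> - 1 / rho \<alpha>\<bar> \<le> cmod (l * \<alpha> - \<beta>) / r ^ 3"
proof -
  define A B where "A = rho \<alpha>" and "B = rho \<beta>"
  have AB: "A \<ge> r" "B \<ge> r" "A > 0" "B > 0" using assms by (auto simp: A_def B_def)
  have "\<bar>A - B\<bar> * (A + B) = \<bar>A\<^sup>2 - B\<^sup>2\<bar>"
    using AB by (simp add: power2_eq_square abs_mult square_diff_square_factored mult.commute)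
  also have "A\<^sup>2 - B\<^sup>2 = (cmod \<beta> - cmod \<alpha>) * (cmod \<alpha> + cmod \<beta>)"
    unfolding A_def B_def rho_sq[OF assms(1)] rho_sq[OF assms(2)] by (simp add: power2_eq_square algebra_simps)
  also have "\<bar>\<dots>\<bar> = \<bar>cmod \<beta> - cmod \<alpha>\<bar> * (cmod \<alpha> + cmod \<beta>)"
    by (simp add: abs_mult)
  also have "\<dots> \<le> cmod (l * \<alpha> - \<beta>) * 2"
  proof (rule mult_mono)
    have "\<bar>cmod (l * \<alpha>) - cmod \<beta>\<bar> \<le> cmod (l * \<alpha> - \<beta>)" by (rule norm_triangle_ineq3)
    then show "\<bar>cmod \<beta> - cmod \<alpha>\<bar> \<le> cmod (l * \<alpha> - \<beta>)"
      using assms by (simp add: norm_mult abs_minus_commute)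
  qed (use assms in auto)
  finally have 1: "\<bar>A - B\<bar> * (A + B) \<le> cmod (l * \<alpha> - \<beta>) * 2" .
  have "\<bar>A - B\<bar> * (2 * r) \<le> \<bar>A - B\<bar> * (A + B)"
    using AB by (intro mult_left_mono) auto
  with 1 have d: "\<bar>A - B\<bar> * r \<le> cmod (l * \<alpha> - \<beta>)" by simp
  have "\<bar>1 / B - 1 / A\<bar> = \<bar>A - B\<bar> / (A * B)"
    using AB by (simp add: field_simps abs_mult)
  also have "\<dots> \<le> \<bar>A - B\<bar> / (r * r)"
    using AB \<open>r > 0\<close> by (intro divide_left_mono mult_mono mult_pos_pos) auto
  also have "\<dots> = \<bar>A - B\<bar> * r / r ^ 3"
    using \<open>r > 0\<close> by (simp add: power3_eq_cube)
  also have "\<dots> \<le> cmod (l * \<alpha> - \<beta>) / r ^ 3"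
    using d \<open>r > 0\<close> by (intro divide_right_mono) auto
  finally show ?thesis by (simp add: A_def B_def)
qed

text \<open>These are the two rows of the conjugated transfer matrix minus the unperturbed one. The
  conjugating factors on the two sides belong to consecutive indices, which is where
  \<open>l' * cnj l - 1\<close> enters.\<close>

lemma transfer_difference:
  fixes \<alpha> \<beta> l l' z p q :: complex and r :: real
  assumes \<alpha>: "cmod \<alpha> < 1" "rho \<alpha> \<ge> r" and \<beta>: "cmod \<beta> < 1" "rho \<beta> \<ge> r" and r: "r > 0"
    and l: "cmod l = 1" "cmod l' = 1" and z: "cmod z = 1" and pq: "cmod q = cmod p"
  defines "\<epsilon> \<equiv> cmod (l * \<alpha> - \<beta>) + cmod (l' * cnj l - 1)"
  shows "cmod ((z * p - cnj \<beta> * q) / of_real (rho \<beta>) - (z * p - cnj \<alpha> * (cnj l * q)) / of_real (rho \<alpha>))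
           \<le> 3 * \<epsilon> / r ^ 3 * cmod p"
    and "cmod (cnj l' * ((q - \<beta> * z * p) / of_real (rho \<beta>)) - (cnj l * q - \<alpha> * z * p) / of_real (rho \<alpha>))
           \<le> 3 * \<epsilon> / r ^ 3 * cmod p"
proof -
  define d where "d = cmod (l * \<alpha> - \<beta>)"
  define e where "e = cmod (l' - l)"
  define ia ib where "ia = complex_of_real (1 / rho \<alpha>)" and "ib = complex_of_real (1 / rho \<beta>)"
  have l1: "l * cnj l = 1" using circle_mult_cnj[OF l(1)] .
  have "l' - l = (l' * cnj l - 1) * l"
    using l1 by (simp add: algebra_simps)
  then have e_eq: "e = cmod (l' * cnj l - 1)"
    using l by (simp add: e_def norm_mult)
  have de: "\<epsilon> = d + e" by (simp add: \<epsilon>_def d_def e_eq)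
  have de0: "d \<ge> 0" "e \<ge> 0" by (simp_all add: d_def e_def)
  have r1: "r \<le> 1" using \<alpha>(2) rho_le_1[of \<alpha>] by linarith
  have ibn: "cmod ib \<le> 1 / r ^ 3"
  proof -
    have "cmod ib = 1 / rho \<beta>" using \<beta> r by (simp add: ib_def norm_divide)
    also have "\<dots> \<le> 1 / r" using \<beta> r by (simp add: frac_le)
    also have "\<dots> \<le> 1 / r ^ 3"
      using r r1 power_decreasing[of 1 3 r] by (intro divide_left_mono) auto
    finally show ?thesis .
  qed
  have iab: "cmod (ib - ia) \<le> d / r ^ 3"
    using inverse_rho_diff[OF \<alpha>(1) \<beta>(1) \<alpha>(2) \<beta>(2) r l(1)]
    unfolding ia_def ib_def d_def of_real_diff[symmetric] norm_of_real by simp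
  \<comment> \<open>Handles differences of products: the numerators' difference is multiplied by
    \<open>ib\<close>, and the common numerator by \<open>ib - ia\<close>.\<close>
  have bound: "cmod (x * ib + y * (ib - ia)) \<le> (k + d) / r ^ 3" if "cmod x \<le> k" "cmod y \<le> 1" for x y k
  proof -
    have "cmod (x * ib) \<le> k * (1 / r ^ 3)"
      unfolding norm_mult using that ibn order_trans[OF norm_ge_zero that(1)] by (intro mult_mono) auto
    moreover have "cmod (y * (ib - ia)) \<le> 1 * (d / r ^ 3)"
      unfolding norm_mult using that iab by (intro mult_mono) auto
    ultimately show ?thesis
      using norm_triangle_ineq[of "x * ib" "y * (ib - ia)"] by (simp add: add_divide_distrib)
  qed
  have comb: "cmod (p1 * X - p2 * Y) \<le> (s + t) / r ^ 3 * cmod p"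
    if "cmod p1 = cmod p" "cmod p2 = cmod p" "cmod X \<le> s / r ^ 3" "cmod Y \<le> t / r ^ 3" for p1 p2 X Y s t
  proof -
    have "cmod (p1 * X - p2 * Y) \<le> cmod p * cmod X + cmod p * cmod Y"
      using norm_triangle_ineq4[of "p1 * X" "p2 * Y"] that by (simp add: norm_mult)
    also have "\<dots> \<le> cmod p * (s / r ^ 3) + cmod p * (t / r ^ 3)"
      using that by (intro add_mono mult_left_mono) auto
    finally show ?thesis by (simp add: algebra_simps add_divide_distrib)
  qed
  have zp: "cmod (z * p) = cmod p" using z by (simp add: norm_mult)
  have mono: "s / r ^ 3 * cmod p \<le> 3 * \<epsilon> / r ^ 3 * cmod p" if "s \<le> 3 * (d + e)" for s
    using that r by (intro mult_right_mono divide_right_mono) (auto simp: de)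
  have "(z * p - cnj \<beta> * q) / of_real (rho \<beta>) - (z * p - cnj \<alpha> * (cnj l * q)) / of_real (rho \<alpha>)
      = (z * p) * (0 * ib + 1 * (ib - ia)) - q * (cnj (\<beta> - l * \<alpha>) * ib + cnj (l * \<alpha>) * (ib - ia))"
    by (simp add: ia_def ib_def algebra_simps diff_divide_distrib)
  moreover have "cmod (\<dots>) \<le> ((0 + d) + (d + d)) / r ^ 3 * cmod p"
    using l \<alpha> zp pq by (intro comb bound) (simp_all add: norm_mult d_def norm_minus_commute del: complex_cnj_mult complex_cnj_diff)
  ultimately show "cmod ((z * p - cnj \<beta> * q) / of_real (rho \<beta>) - (z * p - cnj \<alpha> * (cnj l * q)) / of_real (rho \<alpha>))
           \<le> 3 * \<epsilon> / r ^ 3 * cmod p"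
    using mono[of "(0 + d) + (d + d)"] de0 by simp
  have "cnj l' * \<beta> - \<alpha> = cnj l' * ((\<beta> - l * \<alpha>) - (l' - l) * \<alpha>)"
    using circle_mult_cnj[OF l(2)] by (simp add: algebra_simps)
  then have "cmod (cnj l' * \<beta> - \<alpha>) = cmod ((\<beta> - l * \<alpha>) - (l' - l) * \<alpha>)"
    using l by (simp add: norm_mult)
  also have "\<dots> \<le> d + e * cmod \<alpha>"
    using norm_triangle_ineq4[of "\<beta> - l * \<alpha>" "(l' - l) * \<alpha>"] by (simp add: d_def e_def norm_mult norm_minus_commute)
  also have "\<dots> \<le> d + e * 1"
    using \<alpha> de0 by (intro add_left_mono mult_left_mono) auto
  finally have b: "cmod (cnj l' * \<beta> - \<alpha>) \<le> d + e" by simp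
  have "cnj l' * ((q - \<beta> * z * p) / of_real (rho \<beta>)) - (cnj l * q - \<alpha> * z * p) / of_real (rho \<alpha>)
      = q * (cnj (l' - l) * ib + cnj l * (ib - ia)) - (z * p) * ((cnj l' * \<beta> - \<alpha>) * ib + \<alpha> * (ib - ia))"
    by (simp add: ia_def ib_def algebra_simps diff_divide_distrib)
  moreover have "cmod (\<dots>) \<le> ((e + d) + ((d + e) + d)) / r ^ 3 * cmod p"
    using l \<alpha> zp pq b by (intro comb bound) (simp_all add: e_def del: complex_cnj_diff)
  ultimately show "cmod (cnj l' * ((q - \<beta> * z * p) / of_real (rho \<beta>)) - (cnj l * q - \<alpha> * z * p) / of_real (rho \<alpha>))
           \<le> 3 * \<epsilon> / r ^ 3 * cmod p"
    using mono[of "(e + d) + ((d + e) + d)"] de0 by simp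
qed

text \<open>In \<open>opoly_perturbation\<close>, \<open>A\<close> and \<open>B\<close> are the coordinates of the vector \<open>(x\<^sub>n, cnj \<lambda>\<^sub>n x\<^sub>n\<^sup>*)\<close> with respect to
  the solutions \<open>(\<phi>\<^sub>n, \<phi>\<^sub>n\<^sup>*)\<close> and \<open>(\<psi>\<^sub>n, -\<psi>\<^sub>n\<^sup>*)\<close>, whose determinant is \<open>-2z\<^sup>n\<close>.\<close>

definition osize :: "(nat \<Rightarrow> complex) \<Rightarrow> nat \<Rightarrow> complex \<Rightarrow> real" where
  "osize a n z = cmod (poly (opoly a n) z) + cmod (poly (opoly2 a n) z)"

lemma opoly_perturbation:
  fixes a b lam :: "nat \<Rightarrow> complex" and r :: real
  assumes a: "\<And>k. cmod (a k) < 1" "\<And>k. rho (a k) \<ge> r"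
    and b: "\<And>k. cmod (b k) < 1" "\<And>k. rho (b k) \<ge> r" and r: "r > 0"
    and lam: "\<And>k. cmod (lam k) = 1" and z: "cmod z = 1"
  defines "\<epsilon> \<equiv> \<lambda>k. cmod (lam k * a k - b k) + cmod (lam (k + 1) * cnj (lam k) - 1)"
  shows "cmod (poly (opoly b n) z)
    \<le> 2 * osize a n z * exp (\<Sum>k<n. 3 * \<epsilon> k / r ^ 3 * ((osize a k z)\<^sup>2 + (osize a (Suc k) z)\<^sup>2))"
proof -
  define x where "x n = poly (opoly b n) z" for n
  define y where "y n = poly (ropoly b n) z" for n
  define v where "v n = cnj (lam n) * y n" for n
  define p where "p n = poly (opoly a n) z" for n
  define q where "q n = poly (ropoly a n) z" for n
  define p2 where "p2 n = poly (opoly2 a n) z" for n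
  define q2 where "q2 n = poly (ropoly2 a n) z" for n
  define A where "A n = (x n * q2 n + v n * p2 n) / (2 * z ^ n)" for n
  define B where "B n = (x n * q n - v n * p n) / (2 * z ^ n)" for n
  define S where "S n = cmod (A n) + cmod (B n)" for n
  define t where "t n = osize a n z" for n
  have z0: "z \<noteq> 0" using z by auto
  have pq: "cmod (q n) = cmod (p n)" "cmod (q2 n) = cmod (p2 n)" "cmod (y n) = cmod (x n)" for n
    by (simp_all add: p_def q_def p2_def q2_def x_def y_def norm_ropoly_circle[OF z])
  have t_eq: "t n = cmod (p n) + cmod (p2 n)" for n
    by (simp add: t_def osize_def p_def p2_def)
  have S0: "S n \<ge> 0" for n by (simp add: S_def)
  have t0: "t n \<ge> 0" for n by (simp add: t_eq)
  have x_AB: "x n = A n * p n + B n * p2 n" for n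
  proof -
    have w: "p n * q2 n + q n * p2 n = 2 * z ^ n"
      using wronskian[of a n z] a by (simp add: p_def q_def p2_def q2_def)
    have "A n * p n + B n * p2 n = x n * (p n * q2 n + q n * p2 n) / (2 * z ^ n)"
      unfolding A_def B_def by (simp add: algebra_simps add_divide_distrib diff_divide_distrib)
    then show ?thesis using z0 unfolding w by simp
  qed
  have x_le: "cmod (x n) \<le> S n * t n" for n
  proof -
    have "cmod (x n) \<le> cmod (A n) * cmod (p n) + cmod (B n) * cmod (p2 n)"
      unfolding x_AB[of n] by (metis norm_mult norm_triangle_ineq)
    also have "\<dots> \<le> S n * t n"
      unfolding S_def t_eq by (simp add: algebra_simps)
    finally show ?thesis .
  qed
  \<comment> \<open>Without perturbation \<open>A\<close> and \<open>B\<close> would be constant.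
    Their increments are the defects \<open>e1\<close> and \<open>e2\<close> of the perturbed vector
    in the unperturbed recursion, and a discrete Gronwall argument follows.\<close>
  have S_step: "S (Suc n) \<le> S n * exp (3 * \<epsilon> n / r ^ 3 * ((t n)\<^sup>2 + (t (Suc n))\<^sup>2))" for n
  proof -
    define c where "c = 3 * \<epsilon> n / r ^ 3"
    have c0: "c \<ge> 0" using r by (simp add: c_def \<epsilon>_def)
    define e1 where "e1 = x (Suc n) - (z * x n - cnj (a n) * v n) / of_real (rho (a n))"
    define e2 where "e2 = v (Suc n) - (v n - a n * z * x n) / of_real (rho (a n))"
    have e: "cmod e1 \<le> c * cmod (x n)" "cmod e2 \<le> c * cmod (x n)"
      using transfer_difference[OF a(1)[of n] a(2)[of n] b(1)[of n] b(2)[of n] r lam[of n] lam[of "Suc n"] z pq(3)[of n]]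
      by (simp_all add: e1_def e2_def c_def \<epsilon>_def x_def y_def v_def poly_opoly_Suc poly_ropoly_Suc
        del: opoly.simps ropoly.simps)
    \<comment> \<open>Both companion pairs, including the one with \<open>- p\<close>, follow the
      sign-flipped recursion expected by \<open>wronskian_step\<close>.\<close>
    have sp: "q2 (Suc n) = (q2 n + a n * z * p2 n) / of_real (rho (a n))"
      "p2 (Suc n) = (z * p2 n + cnj (a n) * q2 n) / of_real (rho (a n))"
      "q (Suc n) = (q n + a n * z * (- p n)) / of_real (rho (a n))"
      "- p (Suc n) = (z * (- p n) + cnj (a n) * q n) / of_real (rho (a n))"
      unfolding p_def q_def p2_def q2_def poly_opoly_Suc poly_ropoly_Suc
      by (simp_all add: minus_divide_left)
    have "x (Suc n) * q2 (Suc n) + v (Suc n) * p2 (Suc n)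
        = z * (x n * q2 n + v n * p2 n) + (e1 * q2 (Suc n) + e2 * p2 (Suc n))"
      unfolding wronskian_step[OF a(1)[of n], of z "x n" "v n" "q2 n" "p2 n", symmetric] sp(1,2)[symmetric]
      by (simp add: e1_def e2_def algebra_simps)
    then have "A (Suc n) = A n + (e1 * q2 (Suc n) + e2 * p2 (Suc n)) / (2 * z ^ Suc n)"
      using z0 by (simp add: A_def add_divide_distrib)
    also have "cmod \<dots> \<le> cmod (A n) + cmod ((e1 * q2 (Suc n) + e2 * p2 (Suc n)) / (2 * z ^ Suc n))"
      by (rule norm_triangle_ineq)
    also have "cmod ((e1 * q2 (Suc n) + e2 * p2 (Suc n)) / (2 * z ^ Suc n)) = cmod (e1 * q2 (Suc n) + e2 * p2 (Suc n)) / 2"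
      using z by (simp add: norm_divide norm_mult norm_power)
    also have "cmod (e1 * q2 (Suc n) + e2 * p2 (Suc n)) \<le> (cmod e1 + cmod e2) * cmod (p2 (Suc n))"
      using norm_triangle_ineq[of "e1 * q2 (Suc n)" "e2 * p2 (Suc n)"] by (simp add: norm_mult pq distrib_right)
    finally have A: "cmod (A (Suc n)) \<le> cmod (A n) + (cmod e1 + cmod e2) * cmod (p2 (Suc n)) / 2"
      by simp
    have "x (Suc n) * q (Suc n) + v (Suc n) * (- p (Suc n))
        = z * (x n * q n + v n * (- p n)) + (e1 * q (Suc n) + e2 * (- p (Suc n)))"
      unfolding wronskian_step[OF a(1)[of n], of z "x n" "v n" "q n" "- p n", symmetric] sp(3,4)[symmetric]
      by (simp add: e1_def e2_def algebra_simps)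
    then have "B (Suc n) = B n + (e1 * q (Suc n) - e2 * p (Suc n)) / (2 * z ^ Suc n)"
      using z0 by (simp add: B_def add_divide_distrib diff_divide_distrib)
    also have "cmod \<dots> \<le> cmod (B n) + cmod ((e1 * q (Suc n) - e2 * p (Suc n)) / (2 * z ^ Suc n))"
      by (rule norm_triangle_ineq)
    also have "cmod ((e1 * q (Suc n) - e2 * p (Suc n)) / (2 * z ^ Suc n)) = cmod (e1 * q (Suc n) - e2 * p (Suc n)) / 2"
      using z by (simp add: norm_divide norm_mult norm_power)
    also have "cmod (e1 * q (Suc n) - e2 * p (Suc n)) \<le> (cmod e1 + cmod e2) * cmod (p (Suc n))"
      using norm_triangle_ineq4[of "e1 * q (Suc n)" "e2 * p (Suc n)"] by (simp add: norm_mult pq distrib_right)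
    finally have B: "cmod (B (Suc n)) \<le> cmod (B n) + (cmod e1 + cmod e2) * cmod (p (Suc n)) / 2"
      by simp
    have "S (Suc n) \<le> (cmod (A n) + (cmod e1 + cmod e2) * cmod (p2 (Suc n)) / 2)
        + (cmod (B n) + (cmod e1 + cmod e2) * cmod (p (Suc n)) / 2)"
      using A B unfolding S_def by (rule add_mono)
    also have "\<dots> = S n + (cmod e1 + cmod e2) / 2 * t (Suc n)"
      by (simp add: S_def t_eq field_simps)
    also have "\<dots> \<le> S n + c * (S n * t n) * t (Suc n)"
    proof -
      have "(cmod e1 + cmod e2) / 2 \<le> c * cmod (x n)" using e by simp
      also have "\<dots> \<le> c * (S n * t n)" using x_le c0 by (rule mult_left_mono)
      finally show ?thesis using t0 by (intro add_left_mono mult_right_mono)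
    qed
    also have "\<dots> = S n * (1 + c * (t n * t (Suc n)))" by (simp add: algebra_simps)
    \<comment> \<open>Squares at single levels replace the mixed product, since only squares are
      controlled by the weighted integrals.\<close>
    also have "\<dots> \<le> S n * (1 + c * ((t n)\<^sup>2 + (t (Suc n))\<^sup>2))"
    proof -
      have "2 * (t n * t (Suc n)) \<le> (t n)\<^sup>2 + (t (Suc n))\<^sup>2"
        using sum_squares_bound[of "t n" "t (Suc n)"] by simp
      moreover have "0 \<le> t n * t (Suc n)" using t0 by simp
      ultimately have "t n * t (Suc n) \<le> (t n)\<^sup>2 + (t (Suc n))\<^sup>2" by linarith
      then show ?thesis using c0 S0 by (intro mult_left_mono add_left_mono)
    qed
    also have "\<dots> \<le> S n * exp (c * ((t n)\<^sup>2 + (t (Suc n))\<^sup>2))"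
      using S0 by (intro mult_left_mono exp_ge_add_one_self)
    finally show ?thesis unfolding c_def .
  qed
  have S_le: "S n \<le> 2 * exp (\<Sum>k<n. 3 * \<epsilon> k / r ^ 3 * ((t k)\<^sup>2 + (t (Suc k))\<^sup>2))" for n
  proof (induction n)
    case 0
    \<comment> \<open>Initially \<open>A\<close> and \<open>B\<close> are half the sum and half the
      difference of 1 and \<open>cnj (lam 0)\<close>.\<close>
    have "cmod (1 + cnj (lam 0)) \<le> 2" "cmod (1 - cnj (lam 0)) \<le> 2"
      using norm_triangle_ineq[of 1 "cnj (lam 0)"] norm_triangle_ineq4[of 1 "cnj (lam 0)"] lam[of 0] by simp_all
    then show ?case
      by (simp add: S_def A_def B_def x_def v_def y_def p_def q_def p2_def q2_def norm_divide)
  next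
    case (Suc n)
    have "S (Suc n) \<le> S n * exp (3 * \<epsilon> n / r ^ 3 * ((t n)\<^sup>2 + (t (Suc n))\<^sup>2))" by (rule S_step)
    also have "\<dots> \<le> 2 * exp (\<Sum>k<n. 3 * \<epsilon> k / r ^ 3 * ((t k)\<^sup>2 + (t (Suc k))\<^sup>2))
        * exp (3 * \<epsilon> n / r ^ 3 * ((t n)\<^sup>2 + (t (Suc n))\<^sup>2))"
      using Suc by (intro mult_right_mono) auto
    finally show ?case by (simp add: exp_add mult.assoc)
  qed
  have "cmod (x n) \<le> S n * t n" by (rule x_le)
  also have "\<dots> \<le> (2 * exp (\<Sum>k<n. 3 * \<epsilon> k / r ^ 3 * ((t k)\<^sup>2 + (t (Suc k))\<^sup>2))) * t n"
    using S_le t0 by (intro mult_right_mono)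
  finally show ?thesis by (simp add: x_def t_def mult_ac)
qed

subsection \<open>Weighted estimates\<close>

lemma poly_cis_measurable [measurable]: "(\<lambda>\<theta>. poly p (cis \<theta>)) \<in> borel_measurable borel"
  by (intro borel_measurable_continuous_onI continuous_intros)

lemma integrable_dtheta_bounded:
  fixes g :: "real \<Rightarrow> real"
  assumes "g \<in> borel_measurable borel" "\<And>\<theta>. \<bar>g \<theta>\<bar> \<le> B"
  shows "integrable dtheta g"
  using assms by (intro dtheta.integrable_const_bound[where B = B]) auto

lemma bounded_on_circle:
  fixes g :: "complex \<Rightarrow> real"
  assumes "continuous_on (sphere 0 1) g"
  obtains B where "\<And>\<theta>. \<bar>g (cis \<theta>)\<bar> \<le> B"
proof -
  have "compact (g ` sphere 0 1)"
    using assms by (intro compact_continuous_image) auto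
  then obtain B where "\<forall>x\<in>sphere 0 1. norm (g x) \<le> B"
    by (auto dest!: compact_imp_bounded simp: bounded_iff)
  then show ?thesis by (intro that) auto
qed

text \<open>The polynomial of degree \<open>n\<close> has norm 1 in the Bernstein-Szego measure of
  every level \<open>N \<ge> n\<close>.\<close>

lemma integral_opoly_ratio:
  assumes a: "\<And>k. cmod (a k) < 1" and "n \<le> N"
  shows "integrable dtheta (\<lambda>\<theta>. (cmod (poly (opoly a n) (cis \<theta>)))\<^sup>2 / (cmod (poly (opoly a N) (cis \<theta>)))\<^sup>2)"
    and "(\<integral>\<theta>. (cmod (poly (opoly a n) (cis \<theta>)))\<^sup>2 / (cmod (poly (opoly a N) (cis \<theta>)))\<^sup>2 \<partial>dtheta) = 1"
proof -
  let ?g = "\<lambda>z. (cmod (poly (opoly a n) z))\<^sup>2 / (cmod (poly (opoly a N) z))\<^sup>2"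
  have c: "continuous_on (sphere 0 1) ?g"
    using opoly_circle_nz[of a _ N] a by (intro continuous_intros) auto
  then obtain B where "\<And>\<theta>. \<bar>?g (cis \<theta>)\<bar> \<le> B"
    by (rule bounded_on_circle) blast
  then show "integrable dtheta (\<lambda>\<theta>. ?g (cis \<theta>))"
    by (intro integrable_dtheta_bounded[where B = B]) measurable
  interpret B: circle_measure "bernstein_szego a N"
    using a by (rule circle_measure_bernstein_szego)
  have "1 = (\<integral>z. (cmod (poly (opoly a n) z))\<^sup>2 \<partial>bernstein_szego a N)"
    using orth_upto_bernstein_szego[of a n N] a assms(2) by (simp add: B.orth_integral_norm)
  also have "\<dots> = integral\<^sup>L dtheta_circle ?g"
    by (subst integral_bernstein_szego) (auto intro!: borel_measurable_circle_continuous continuous_intros)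
  also have "\<dots> = (\<integral>\<theta>. ?g (cis \<theta>) \<partial>dtheta)"
    by (rule integral_dtheta_circle) (rule borel_measurable_circle_continuous[OF c])
  finally show "(\<integral>\<theta>. ?g (cis \<theta>) \<partial>dtheta) = 1" by simp
qed

text \<open>The absolutely continuous part is dominated by \<open>\<mu>\<close>, where the
  polynomial has norm 1. As \<open>w\<close> is nonnegative only almost everywhere,
  \<open>max 0\<close> mirrors the truncation by \<open>ennreal\<close>.\<close>

lemma integral_weight_opoly:
  assumes nt: "nontrivial_prob_on_circle \<mu>" and dec: "lebesgue_decomposition \<mu> w \<mu>s"
  shows "integrable dtheta (\<lambda>\<theta>. max 0 (w \<theta>) * (cmod (poly (opoly (verblunsky \<mu>) n) (cis \<theta>)))\<^sup>2)"
    and "(\<integral>\<theta>. max 0 (w \<theta>) * (cmod (poly (opoly (verblunsky \<mu>) n) (cis \<theta>)))\<^sup>2 \<partial>dtheta) \<le> 1"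
proof -
  interpret M: circle_measure \<mu> using nt by (rule circle_measure_nontrivial)
  let ?p = "poly (opoly (verblunsky \<mu>) n)"
  let ?g = "\<lambda>\<theta>. max 0 (w \<theta>) * (cmod (?p (cis \<theta>)))\<^sup>2"
  have w [measurable]: "w \<in> borel_measurable borel"
    using dec by (simp add: lebesgue_decomposition_def cong: measurable_cong_sets)
  let ?D = "distr (density dtheta (\<lambda>\<theta>. ennreal (w \<theta>))) circle_borel cis"
  have "?D \<le> \<mu>"
    using dec M.sets_M by (subst le_measure) (auto simp: lebesgue_decomposition_def)
  have "(\<integral>\<^sup>+\<theta>. ennreal (?g \<theta>) \<partial>dtheta) = (\<integral>\<^sup>+\<theta>. ennreal (w \<theta>) * ennreal ((cmod (?p (cis \<theta>)))\<^sup>2) \<partial>dtheta)"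
    by (intro nn_integral_cong) (simp add: ennreal_mult' ennreal_max_0)
  also have "\<dots> = (\<integral>\<^sup>+\<theta>. ennreal ((cmod (?p (cis \<theta>)))\<^sup>2) \<partial>density dtheta (\<lambda>\<theta>. ennreal (w \<theta>)))"
    by (rule nn_integral_density[symmetric]) auto
  also have "\<dots> = (\<integral>\<^sup>+z. ennreal ((cmod (?p z))\<^sup>2) \<partial>?D)"
    by (rule nn_integral_distr[symmetric]) auto
  also have "\<dots> \<le> (\<integral>\<^sup>+z. ennreal ((cmod (?p z))\<^sup>2) \<partial>\<mu>)"
    by (rule nn_integral_mono_measure[OF _ \<open>?D \<le> \<mu>\<close>]) (simp add: M.sets_M)
  also have "\<dots> = ennreal (\<integral>z. (cmod (?p z))\<^sup>2 \<partial>\<mu>)"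
    by (rule nn_integral_eq_integral) (auto intro!: M.integrable_continuous continuous_intros)
  also have "(\<integral>z. (cmod (?p z))\<^sup>2 \<partial>\<mu>) = 1"
    using orth_upto_verblunsky[OF nt] norm_verblunsky_less_1[OF nt] by (rule M.orth_integral_norm)
  finally have le: "(\<integral>\<^sup>+\<theta>. ennreal (?g \<theta>) \<partial>dtheta) \<le> 1" by simp
  show int: "integrable dtheta ?g"
    using le by (intro integrableI_nonneg) (auto simp: order_le_less_trans)
  have "ennreal (integral\<^sup>L dtheta ?g) = (\<integral>\<^sup>+\<theta>. ennreal (?g \<theta>) \<partial>dtheta)"
    using int by (intro nn_integral_eq_integral[symmetric]) auto
  with le have "ennreal (integral\<^sup>L dtheta ?g) \<le> ennreal 1" by simp
  then show "integral\<^sup>L dtheta ?g \<le> 1"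
    by (subst (asm) ennreal_le_iff) auto
qed

text \<open>With \<open>F = \<psi>\<^sub>n\<^sup>* / \<phi>\<^sub>n\<^sup>*\<close>, which has positive real part, \<open>Re (F / (F + L)) \<ge> 1/4\<close> where \<open>\<bar>F\<bar> \<ge> L\<close>, while the
  mean of \<open>F / (F + L)\<close> is its value \<open>1 / (1 + L)\<close> at the origin.\<close>

lemma opoly2_opoly_weak_type:
  assumes a: "\<And>k. cmod (a k) < 1" and L: "L > 0"
  shows "measure dtheta {\<theta>. cmod (poly (opoly2 a n) (cis \<theta>)) \<ge> L * cmod (poly (opoly a n) (cis \<theta>))} \<le> 4 / (1 + L)"
proof -
  define p where "p z = poly (ropoly a n) z" for z
  define q where "q z = poly (ropoly2 a n) z" for z
  let ?g = "\<lambda>z. q z / (q z + of_real L * p z)"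
  have nz: "q z + of_real L * p z \<noteq> 0" if "cmod z \<le> 1" for z
  proof -
    have "p z + of_real (1 / L) * q z \<noteq> 0"
      using ropoly_combination_disc[of a z "1 / L" n] a that L by (simp add: p_def q_def)
    moreover have "q z + of_real L * p z = of_real L * (p z + of_real (1 / L) * q z)"
      using L by (simp add: algebra_simps)
    ultimately show ?thesis using L by simp
  qed
  have q_nz: "q z \<noteq> 0" if "cmod z \<le> 1" for z
    unfolding q_def using a that by (intro ropoly_nz) auto
  have cont: "continuous_on (cball 0 1) ?g"
    using nz unfolding p_def q_def by (intro continuous_intros) auto
  have contS: "continuous_on (sphere 0 1) ?g"
    by (rule continuous_on_subset[OF cont]) auto
  have "integral\<^sup>L dtheta_circle ?g = ?g 0"
    using nz by (intro mean_value_circle cont) (auto intro!: holomorphic_intros simp: p_def q_def)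
  also have "?g 0 = of_real (1 / (1 + L))"
  proof -
    have "rho_prod a n > 0" "rho_prod (\<lambda>k. - a k) n = rho_prod a n"
      using rho_prod_pos[of n a] a by (simp_all add: rho_prod_def)
    then show ?thesis using L by (simp add: p_def q_def poly_ropoly_0 field_simps)
  qed
  also have "integral\<^sup>L dtheta_circle ?g = (\<integral>\<theta>. ?g (cis \<theta>) \<partial>dtheta)"
    by (intro integral_dtheta_circle borel_measurable_circle_continuous contS)
  finally have mean: "(\<integral>\<theta>. ?g (cis \<theta>) \<partial>dtheta) = of_real (1 / (1 + L))" .
  have int: "integrable dtheta (\<lambda>\<theta>. ?g (cis \<theta>))"
  proof -
    obtain B where "\<And>\<theta>. \<bar>cmod (?g (cis \<theta>))\<bar> \<le> B"
      using bounded_on_circle[OF continuous_on_norm[OF contS]] by blast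
    then show ?thesis
      unfolding p_def q_def by (intro dtheta.integrable_const_bound[where B = B]) auto
  qed
  \<comment> \<open>After multiplication by the conjugate denominator, the cross term is
    \<open>L\<close> times the real part of \<open>q z * cnj (p z)\<close>, which the Wronskian
    identity fixes to 1.\<close>
  have Re_g: "Re (?g z) = ((cmod (q z))\<^sup>2 + L) / (cmod (q z + of_real L * p z))\<^sup>2" if z: "cmod z = 1" for z
  proof -
    have p': "poly (opoly a n) z = z ^ n * cnj (p z)" and q': "poly (opoly2 a n) z = z ^ n * cnj (q z)"
    proof -
      have zz: "z ^ n * cnj z ^ n = 1"
        using circle_mult_cnj[OF z] by (simp add: power_mult_distrib[symmetric])
      show "poly (opoly a n) z = z ^ n * cnj (p z)" "poly (opoly2 a n) z = z ^ n * cnj (q z)"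
        using zz by (simp_all add: p_def q_def ropoly_circle[OF z] mult.assoc[symmetric])
    qed
    have "z ^ n * (cnj (p z) * q z + p z * cnj (q z)) = z ^ n * 2"
      using wronskian[of a n z] a unfolding p' q' p_def[symmetric] q_def[symmetric] by (simp add: algebra_simps)
    then have "cnj (p z) * q z + p z * cnj (q z) = 2"
      using z by auto
    then have "Re (cnj (p z) * q z + p z * cnj (q z)) = 2" by simp
    then have "Re (q z * cnj (p z)) = 1" by (simp add: algebra_simps)
    then have "Re (q z * cnj (q z + of_real L * p z)) = (cmod (q z))\<^sup>2 + L"
      unfolding cmod_power2 by (simp add: power2_eq_square algebra_simps)
    then show ?thesis
      by (subst complex_div_cnj) (simp add: Re_divide_of_real del: of_real_power)
  qed
  have Re_pos: "0 \<le> Re (?g (cis \<theta>))" for \<theta>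
    using L by (subst Re_g) auto
  let ?E = "{\<theta>. cmod (poly (opoly2 a n) (cis \<theta>)) \<ge> L * cmod (poly (opoly a n) (cis \<theta>))}"
  have E: "Re (?g (cis \<theta>)) \<ge> 1 / 4" if "\<theta> \<in> ?E" for \<theta>
  proof -
    have "L * cmod (p (cis \<theta>)) \<le> cmod (q (cis \<theta>))"
      using that norm_ropoly_circle[of "cis \<theta>"] by (simp add: p_def q_def)
    then have "cmod (q (cis \<theta>) + of_real L * p (cis \<theta>)) \<le> 2 * cmod (q (cis \<theta>))"
      using L norm_triangle_ineq[of "q (cis \<theta>)" "of_real L * p (cis \<theta>)"] by (simp add: norm_mult)
    then have "(cmod (q (cis \<theta>) + of_real L * p (cis \<theta>)))\<^sup>2 \<le> (2 * cmod (q (cis \<theta>)))\<^sup>2"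
      by (intro power_mono) auto
    then have "1 / 4 * (cmod (q (cis \<theta>) + of_real L * p (cis \<theta>)))\<^sup>2 \<le> (cmod (q (cis \<theta>)))\<^sup>2 + L"
      using L by (simp add: power_mult_distrib)
    then show ?thesis
      using nz[of "cis \<theta>"] by (subst Re_g) (auto simp: pos_le_divide_eq)
  qed
  have "measure dtheta ?E \<le> measure dtheta {\<theta> \<in> space dtheta. Re (?g (cis \<theta>)) \<ge> 1 / 4}"
    using E unfolding p_def q_def by (intro dtheta.finite_measure_mono) auto
  also have "\<dots> \<le> (\<integral>\<theta>. Re (?g (cis \<theta>)) \<partial>dtheta) / (1 / 4)"
    using int Re_pos by (intro integral_Markov_inequality_measure[where A = "{}"]) auto
  also have "(\<integral>\<theta>. Re (?g (cis \<theta>)) \<partial>dtheta) = 1 / (1 + L)"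
    using int mean by (simp add: integral_Re)
  finally show ?thesis by simp
qed

text \<open>Markov's inequality bounds \<open>opoly\<close> on \<open>K\<close>, where the weight is
  at least \<open>\<delta>\<close>. For \<open>opoly2\<close> only the ratio to \<open>opoly\<close>
  is controlled, so with threshold \<open>T = L\<^sup>2\<close> either \<open>opoly\<close> is at
  least \<open>L\<close> or the ratio is at least \<open>L\<close>.\<close>

lemma opoly_tight:
  assumes nt: "nontrivial_prob_on_circle \<mu>" and dec: "lebesgue_decomposition \<mu> w \<mu>s"
    and K: "K \<in> sets borel" "\<delta> > 0" "\<And>\<theta>. \<theta> \<in> K \<Longrightarrow> w \<theta> \<ge> \<delta>" and e: "e > 0"
  shows "\<exists>T\<ge>1. \<forall>n. measure dtheta {\<theta> \<in> K. cmod (poly (opoly (verblunsky \<mu>) n) (cis \<theta>)) > T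
    \<or> cmod (poly (opoly2 (verblunsky \<mu>) n) (cis \<theta>)) > T} \<le> e"
proof -
  have "((\<lambda>L. 1 / (\<delta> * L\<^sup>2) + 4 / (1 + L)) \<longlongrightarrow> 0) at_top"
    using K(2) by real_asymp
  then have "\<forall>\<^sub>F L in at_top. 1 / (\<delta> * L\<^sup>2) + 4 / (1 + L) < e"
    using e by (rule order_tendstoD)
  then have "\<forall>\<^sub>F L in at_top. 1 / (\<delta> * L\<^sup>2) + 4 / (1 + L) < e \<and> L \<ge> 1"
    using eventually_ge_at_top by (rule eventually_conj)
  then obtain L where L: "1 / (\<delta> * L\<^sup>2) + 4 / (1 + L) < e" "L \<ge> 1"
    by (auto dest: eventually_happens)
  let ?a = "verblunsky \<mu>"
  have a: "\<And>k. cmod (?a k) < 1" using nt by (rule norm_verblunsky_less_1)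
  note K(1) [measurable]
  have w [measurable]: "w \<in> borel_measurable borel"
    using dec by (simp add: lebesgue_decomposition_def cong: measurable_cong_sets)
  show ?thesis
  proof (intro exI[of _ "L\<^sup>2"] conjI allI)
    show "1 \<le> L\<^sup>2" using L by simp
    fix n
    let ?p = "\<lambda>\<theta>. cmod (poly (opoly ?a n) (cis \<theta>))" and ?q = "\<lambda>\<theta>. cmod (poly (opoly2 ?a n) (cis \<theta>))"
    let ?A = "{\<theta> \<in> space dtheta. \<delta> * L\<^sup>2 \<le> max 0 (w \<theta>) * (?p \<theta>)\<^sup>2}"
    let ?B = "{\<theta>. ?q \<theta> \<ge> L * ?p \<theta>}"
    have "{\<theta> \<in> K. ?p \<theta> > L\<^sup>2 \<or> ?q \<theta> > L\<^sup>2} \<subseteq> ?A \<union> ?B"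
    proof
      fix \<theta> assume \<theta>: "\<theta> \<in> {\<theta> \<in> K. ?p \<theta> > L\<^sup>2 \<or> ?q \<theta> > L\<^sup>2}"
      have L2: "L * 1 \<le> L\<^sup>2" unfolding power2_eq_square using L by (intro mult_left_mono) auto
      show "\<theta> \<in> ?A \<union> ?B"
      proof (cases "?p \<theta> \<ge> L")
        case True
        have "\<delta> * L\<^sup>2 \<le> max 0 (w \<theta>) * (?p \<theta>)\<^sup>2"
          using K(2) K(3)[of \<theta>] \<theta> True L by (intro mult_mono power_mono) auto
        then show ?thesis by simp
      next
        case False
        then have "?q \<theta> > L\<^sup>2" using \<theta> L2 by auto
        moreover have "L * ?p \<theta> \<le> L * L" using False L by (intro mult_left_mono) auto
        ultimately show ?thesis by (simp add: power2_eq_square)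
      qed
    qed
    then have "measure dtheta {\<theta> \<in> K. ?p \<theta> > L\<^sup>2 \<or> ?q \<theta> > L\<^sup>2} \<le> measure dtheta (?A \<union> ?B)"
      by (intro dtheta.finite_measure_mono) auto
    also have "\<dots> \<le> measure dtheta ?A + measure dtheta ?B"
      by (intro measure_Un_le) auto
    also have "measure dtheta ?A \<le> (\<integral>\<theta>. max 0 (w \<theta>) * (?p \<theta>)\<^sup>2 \<partial>dtheta) / (\<delta> * L\<^sup>2)"
      using integral_weight_opoly[OF nt dec, of n] K(2) L
      by (intro integral_Markov_inequality_measure[where A = "{}"]) auto
    also have "\<dots> \<le> 1 / (\<delta> * L\<^sup>2)"
      using integral_weight_opoly[OF nt dec, of n] K(2) by (intro divide_right_mono) auto
    also have "measure dtheta ?B \<le> 4 / (1 + L)"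
      using a L by (intro opoly2_opoly_weak_type) auto
    finally show "measure dtheta {\<theta> \<in> K. ?p \<theta> > L\<^sup>2 \<or> ?q \<theta> > L\<^sup>2} \<le> e" using L by simp
  qed
qed

text \<open>Two consecutive transfer matrices are both bounded somewhere on \<open>K\<close>, hence so is their quotient,
  whose entries are of size \<open>1 / rho\<close>.\<close>

lemma rho_verblunsky_bounded_below:
  assumes nt: "nontrivial_prob_on_circle \<mu>" and dec: "lebesgue_decomposition \<mu> w \<mu>s"
    and K: "K \<in> sets borel" "\<delta> > 0" "\<And>\<theta>. \<theta> \<in> K \<Longrightarrow> w \<theta> \<ge> \<delta>" "measure dtheta K > 0"
  shows "\<exists>r>0. \<forall>n. rho (verblunsky \<mu> n) \<ge> r"
proof -
  let ?a = "verblunsky \<mu>"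
  have a: "\<And>k. cmod (?a k) < 1" using nt by (rule norm_verblunsky_less_1)
  let ?p = "\<lambda>n \<theta>. cmod (poly (opoly ?a n) (cis \<theta>))" and ?q = "\<lambda>n \<theta>. cmod (poly (opoly2 ?a n) (cis \<theta>))"
  have "\<exists>T\<ge>1. \<forall>n. measure dtheta {\<theta> \<in> K. ?p n \<theta> > T \<or> ?q n \<theta> > T} \<le> measure dtheta K / 4"
  proof (rule opoly_tight[OF nt dec K(1-3)])
    show "measure dtheta K / 4 > 0" using K(4) by simp
  qed
  then obtain T where T: "T \<ge> 1" "\<And>n. measure dtheta {\<theta> \<in> K. ?p n \<theta> > T \<or> ?q n \<theta> > T} \<le> measure dtheta K / 4"
    by blast
  note K(1) [measurable]
  have "rho (?a n) \<ge> 1 / T\<^sup>2" for n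
  proof -
    let ?B = "\<lambda>n. {\<theta> \<in> K. ?p n \<theta> > T \<or> ?q n \<theta> > T}"
    \<comment> \<open>Two exceptional sets of a quarter of the measure of \<open>K\<close> leave a
      point that is good for both levels.\<close>
    have "\<not> K \<subseteq> ?B n \<union> ?B (Suc n)"
    proof
      assume "K \<subseteq> ?B n \<union> ?B (Suc n)"
      then have "measure dtheta K \<le> measure dtheta (?B n \<union> ?B (Suc n))"
        by (intro dtheta.finite_measure_mono) (auto simp del: opoly.simps)
      also have "\<dots> \<le> measure dtheta (?B n) + measure dtheta (?B (Suc n))"
        by (intro measure_Un_le) (auto simp del: opoly.simps)
      finally show False using T(2)[of n] T(2)[of "Suc n"] K(4) by linarith
    qed
    then obtain \<theta> where "\<theta> \<in> K" "\<theta> \<notin> ?B n" "\<theta> \<notin> ?B (Suc n)"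
      by blast
    then have \<theta>: "?p n \<theta> \<le> T" "?q n \<theta> \<le> T" "?p (Suc n) \<theta> \<le> T" "?q (Suc n) \<theta> \<le> T"
      by (simp_all add: not_less del: opoly.simps)
    define z where "z = cis \<theta>"
    have z: "cmod z = 1" by (simp add: z_def)
    have "2 / rho (?a n) = cmod (2 * z ^ n / of_real (rho (?a n)))"
      using rho_pos[OF a[of n]] z by (simp add: norm_divide norm_mult norm_power)
    also have "\<dots> \<le> ?q n \<theta> * ?p (Suc n) \<theta> + ?p n \<theta> * ?q (Suc n) \<theta>"
      unfolding wronskian_shift[of ?a n z, OF a, symmetric]
      by (rule order_trans[OF norm_triangle_ineq])
         (simp add: norm_mult norm_ropoly_circle[OF z] z_def[symmetric] del: opoly.simps ropoly.simps)
    also have "\<dots> \<le> T * T + T * T"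
      using \<theta> T(1) by (intro add_mono mult_mono) auto
    finally have "1 / rho (?a n) \<le> T\<^sup>2" by (simp add: power2_eq_square)
    then show ?thesis
      using rho_pos[OF a[of n]] T(1) by (simp add: field_simps)
  qed
  then show ?thesis using T(1) by (intro exI[of _ "1 / T\<^sup>2"]) auto
qed

text \<open>The \<open>a n\<close> stay in a disc of radius \<open>s < 1\<close>, so eventually the
  \<open>b n\<close> have modulus at most \<open>(1 + s) / 2\<close>; the finitely many others are
  absorbed by a maximum.\<close>

lemma rho_bounded_below_perturb:
  fixes a b lam :: "nat \<Rightarrow> complex"
  assumes r: "r > 0" "\<And>n. rho (a n) \<ge> r" and a: "\<And>n. cmod (a n) < 1" and b: "\<And>n. cmod (b n) < 1"
    and lam: "\<And>n. cmod (lam n) = 1" and lim: "(\<lambda>n. cmod (lam n * a n - b n)) \<longlonglongrightarrow> 0"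
  shows "\<exists>r>0. \<forall>n. rho (b n) \<ge> r"
proof -
  define s where "s = sqrt (1 - r\<^sup>2)"
  have r1: "r \<le> 1" using r(2)[of 0] rho_le_1[of "a 0"] by linarith
  then have r2: "r\<^sup>2 \<le> 1" using r(1) by (simp add: power_le_one)
  have s1: "s < 1" unfolding s_def using r(1) by simp
  have as: "cmod (a n) \<le> s" for n
  proof -
    have "r\<^sup>2 \<le> 1 - (cmod (a n))\<^sup>2"
      unfolding rho_sq[OF a, symmetric] using r by (intro power_mono) auto
    then show ?thesis unfolding s_def by (intro real_le_rsqrt) simp
  qed
  have "\<forall>\<^sub>F n in sequentially. cmod (lam n * a n - b n) < (1 - s) / 2"
    using lim by (rule order_tendstoD) (use s1 in simp)
  then obtain N where N: "\<And>n. n \<ge> N \<Longrightarrow> cmod (lam n * a n - b n) < (1 - s) / 2"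
    by (auto simp: eventually_sequentially)
  define M where "M = Max (insert ((1 + s) / 2) ((\<lambda>n. cmod (b n)) ` {..<N}))"
  have M1: "M < 1" unfolding M_def using s1 b by (subst Max_less_iff) auto
  have bM: "cmod (b n) \<le> M" for n
  proof (cases "n < N")
    case True
    then show ?thesis unfolding M_def by (intro Max_ge) auto
  next
    case False
    have "cmod (b n) \<le> cmod (lam n * a n) + cmod (lam n * a n - b n)"
      using norm_triangle_ineq4[of "lam n * a n" "lam n * a n - b n"] by simp
    also have "cmod (lam n * a n) = cmod (a n)" by (simp add: norm_mult lam)
    also have "cmod (a n) + cmod (lam n * a n - b n) \<le> s + (1 - s) / 2"
      using as[of n] N[of n] False by linarith
    also have "\<dots> = (1 + s) / 2" by (simp add: field_simps)
    also have "\<dots> \<le> M" unfolding M_def by (intro Max_ge) auto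
    finally show ?thesis .
  qed
  have "M \<ge> 0" using order_trans[OF norm_ge_zero bM[of 0]] .
  have "rho (b n) \<ge> sqrt (1 - M\<^sup>2)" for n
    unfolding rho_def using bM[of n] by (simp add: power_mono)
  moreover have "M\<^sup>2 < 1" using M1 \<open>M \<ge> 0\<close> by (simp add: power_less_one_iff abs_square_less_1)
  ultimately show ?thesis by (intro exI[of _ "sqrt (1 - M\<^sup>2)"]) auto
qed

subsection \<open>Comparison of the supports\<close>

text \<open>If \<open>K\<close> had measure \<open>\<kappa> > 0\<close>, three sets of measure at
  most \<open>\<kappa> / 4\<close> would cover it: large solutions for \<open>\<mu>\<close> in
  \<open>?B1\<close>, small polynomials for \<open>\<nu>\<close> in \<open>?B2\<close>, large
  weighted growth in \<open>?B3\<close>. Off the first two, the perturbation bound forces the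
  third.\<close>

lemma measure_zero_if_perturbed_null:
  fixes lam :: "nat \<Rightarrow> complex"
  assumes lam: "\<And>n. cmod (lam n) = 1"
    and mu: "nontrivial_prob_on_circle \<mu>" "lebesgue_decomposition \<mu> w \<mu>s"
    and nu: "nontrivial_prob_on_circle \<nu>"
    and K: "compact K" "\<delta> > 0" "\<And>\<theta>. \<theta> \<in> K \<Longrightarrow> w \<theta> \<ge> \<delta>" "measure \<nu> (cis ` K) = 0"
    and sm: "summable (\<lambda>j. cmod (lam j * verblunsky \<mu> j - verblunsky \<nu> j) + cmod (lam (j + 1) * cnj (lam j) - 1))"
      (is "summable ?\<epsilon>")
  shows "measure dtheta K = 0"
proof (rule ccontr)
  define \<kappa> where "\<kappa> = measure dtheta K"
  assume "measure dtheta K \<noteq> 0"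
  then have \<kappa>: "\<kappa> > 0" by (simp add: \<kappa>_def order_less_le)
  let ?a = "verblunsky \<mu>" and ?b = "verblunsky \<nu>"
  have a: "\<And>k. cmod (?a k) < 1" using mu(1) by (rule norm_verblunsky_less_1)
  have b: "\<And>k. cmod (?b k) < 1" using nu by (rule norm_verblunsky_less_1)
  have w [measurable]: "w \<in> borel_measurable borel"
    using mu(2) by (simp add: lebesgue_decomposition_def cong: measurable_cong_sets)
  have K_borel [measurable]: "K \<in> sets borel" using K(1) by (rule borel_compact)
  obtain r1 where r1: "r1 > 0" "\<And>n. rho (?a n) \<ge> r1"
    using rho_verblunsky_bounded_below[OF mu K_borel K(2,3)] \<kappa> unfolding \<kappa>_def by blast
  have "(\<lambda>j. cmod (lam j * ?a j - ?b j)) \<longlonglongrightarrow> 0"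
    by (rule tendsto_sandwich[OF _ _ tendsto_const summable_LIMSEQ_zero[OF sm]]) auto
  then obtain r2 where r2: "r2 > 0" "\<And>n. rho (?b n) \<ge> r2"
    using rho_bounded_below_perturb[of r1 ?a ?b lam, OF r1 a b lam] by blast
  define r where "r = min r1 r2"
  have r: "r > 0" "\<And>n. rho (?a n) \<ge> r" "\<And>n. rho (?b n) \<ge> r"
    using r1 r2 by (auto simp: r_def min_le_iff_disj)
  let ?p = "\<lambda>n \<theta>. cmod (poly (opoly ?a n) (cis \<theta>))" and ?q = "\<lambda>n \<theta>. cmod (poly (opoly2 ?a n) (cis \<theta>))"
  let ?x = "\<lambda>n \<theta>. cmod (poly (opoly ?b n) (cis \<theta>))"
  have "\<exists>T\<ge>1. \<forall>n. measure dtheta {\<theta> \<in> K. ?p n \<theta> > T \<or> ?q n \<theta> > T} \<le> \<kappa> / 4"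
  proof (rule opoly_tight[OF mu K_borel K(2,3)])
    show "\<kappa> / 4 > 0" using \<kappa> by simp
  qed
  then obtain T where T: "T \<ge> 1" "\<And>n. measure dtheta {\<theta> \<in> K. ?p n \<theta> > T \<or> ?q n \<theta> > T} \<le> \<kappa> / 4"
    by blast
  \<comment> \<open>Lower bound for the weight \<open>G\<close> on \<open>K\<close> off
    \<open>?B1\<close>, uniform in the level.\<close>
  define \<gamma> where "\<gamma> = min \<delta> (1 / T\<^sup>2)"
  have \<gamma>: "\<gamma> > 0" using K(2) T(1) by (simp add: \<gamma>_def)
  define c where "c k = 3 * ?\<epsilon> k / r ^ 3" for k
  have c0: "c k \<ge> 0" for k using r by (simp add: c_def)
  have c_sum: "summable c" unfolding c_def using sm by (intro summable_divide summable_mult)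
  \<comment> \<open>Bounds the integral of \<open>G \<theta> * R \<theta>\<close> independently of
    \<open>N\<close>: each weighted square contributes at most 4, and each \<open>c k\<close>
    multiplies two of them.\<close>
  define C where "C = ln 2 + 4 + 8 * suminf c"
  have "suminf c \<ge> 0" using c_sum c0 by (rule suminf_nonneg)
  then have C: "C > 0" by (simp add: C_def add_pos_nonneg)
  \<comment> \<open>Makes \<open>C / (\<gamma> * ln M)\<close> equal to \<open>\<kappa> / 4\<close>.
    The level \<open>N\<close> is chosen only after \<open>M\<close>.\<close>
  define M where "M = exp (4 * C / (\<gamma> * \<kappa>))"
  have M: "M > 0" "ln M = 4 * C / (\<gamma> * \<kappa>)" by (simp_all add: M_def)
  have lnM: "ln M > 0" unfolding M using C \<gamma> \<kappa> by simp
  have cisK: "compact (cis ` K)" "cis ` K \<subseteq> sphere 0 1"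
    using K(1) by (auto intro!: compact_continuous_image continuous_intros)
  have "\<forall>\<^sub>F n in sequentially. measure (bernstein_szego ?b n) (cis ` K) \<le> \<kappa> / (4 * M\<^sup>2)"
    by (rule bernstein_szego_compact_null[OF nu cisK K(4)]) (use \<kappa> M in simp)
  then obtain N where N: "measure (bernstein_szego ?b N) (cis ` K) \<le> \<kappa> / (4 * M\<^sup>2)"
    by (auto dest: eventually_happens)

  define t where "t n \<theta> = osize ?a n (cis \<theta>)" for n \<theta>
  have t_eq: "t n \<theta> = ?p n \<theta> + ?q n \<theta>" for n \<theta> by (simp add: t_def osize_def)
  have [measurable]: "t n \<in> borel_measurable borel" for n unfolding t_eq by measurable
  \<comment> \<open>The first entry of the minimum controls \<open>opoly\<close>; the second is the
    Bernstein-Szego density for the coefficients \<open>- ?a k\<close> and controls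
    \<open>opoly2\<close> up to level \<open>N\<close>.\<close>
  define G where "G \<theta> = min (max 0 (w \<theta>)) (1 / (?q N \<theta>)\<^sup>2)" for \<theta>
  have [measurable]: "G \<in> borel_measurable borel" unfolding G_def by measurable
  have G0: "G \<theta> \<ge> 0" for \<theta> by (simp add: G_def)
  have a': "cmod (- ?a k) < 1" for k using a by simp
  have int_t: "integrable dtheta (\<lambda>\<theta>. G \<theta> * (t n \<theta>)\<^sup>2)" "(\<integral>\<theta>. G \<theta> * (t n \<theta>)\<^sup>2 \<partial>dtheta) \<le> 4" if "n \<le> N" for n
  proof -
    let ?H = "\<lambda>\<theta>. 2 * (max 0 (w \<theta>) * (?p n \<theta>)\<^sup>2) + 2 * ((?q n \<theta>)\<^sup>2 / (?q N \<theta>)\<^sup>2)"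
    note intp = integral_weight_opoly[OF mu, of n]
    note intq = integral_opoly_ratio[of "\<lambda>k. - ?a k", OF a' that]
    have int2: "integrable dtheta (\<lambda>\<theta>. 2 * (max 0 (w \<theta>) * (?p n \<theta>)\<^sup>2))"
      "integrable dtheta (\<lambda>\<theta>. 2 * ((?q n \<theta>)\<^sup>2 / (?q N \<theta>)\<^sup>2))"
      by (rule integrable_mult_right, rule intp(1), rule integrable_mult_right, rule intq(1))
    then have H: "integrable dtheta ?H"
      by (rule Bochner_Integration.integrable_add)
    have "integral\<^sup>L dtheta ?H = 2 * (\<integral>\<theta>. max 0 (w \<theta>) * (?p n \<theta>)\<^sup>2 \<partial>dtheta) + 2 * 1"
      unfolding Bochner_Integration.integral_add[OF int2] integral_mult_right_zero intq(2) ..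
    then have H4: "integral\<^sup>L dtheta ?H \<le> 4"
      using intp(2) by linarith
    have le: "G \<theta> * (t n \<theta>)\<^sup>2 \<le> ?H \<theta>" for \<theta>
    proof -
      have "(t n \<theta>)\<^sup>2 \<le> 2 * (?p n \<theta>)\<^sup>2 + 2 * (?q n \<theta>)\<^sup>2"
        using sum_squares_bound[of "?p n \<theta>" "?q n \<theta>"] unfolding t_eq power2_sum by linarith
      then have "G \<theta> * (t n \<theta>)\<^sup>2 \<le> G \<theta> * (2 * (?p n \<theta>)\<^sup>2 + 2 * (?q n \<theta>)\<^sup>2)"
        using G0 by (rule mult_left_mono)
      also have "\<dots> = 2 * (G \<theta> * (?p n \<theta>)\<^sup>2) + 2 * (G \<theta> * (?q n \<theta>)\<^sup>2)"
        by (simp add: algebra_simps)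
      also have "G \<theta> * (?p n \<theta>)\<^sup>2 \<le> max 0 (w \<theta>) * (?p n \<theta>)\<^sup>2"
        by (intro mult_right_mono) (simp_all add: G_def)
      also have "G \<theta> * (?q n \<theta>)\<^sup>2 \<le> 1 / (?q N \<theta>)\<^sup>2 * (?q n \<theta>)\<^sup>2"
        by (intro mult_right_mono) (simp_all add: G_def)
      finally show ?thesis by simp
    qed
    have "0 \<le> G \<theta> * (t n \<theta>)\<^sup>2" for \<theta> using G0 by simp
    then show int: "integrable dtheta (\<lambda>\<theta>. G \<theta> * (t n \<theta>)\<^sup>2)"
      using le by (intro Bochner_Integration.integrable_bound[OF H]) (auto intro!: AE_I2 order_trans[OF _ abs_ge_self])
    have "(\<integral>\<theta>. G \<theta> * (t n \<theta>)\<^sup>2 \<partial>dtheta) \<le> integral\<^sup>L dtheta ?H"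
      by (rule integral_mono[OF int H le])
    with H4 show "(\<integral>\<theta>. G \<theta> * (t n \<theta>)\<^sup>2 \<partial>dtheta) \<le> 4" by linarith
  qed
  have int_G: "integrable dtheta G" "integral\<^sup>L dtheta G \<le> 1"
  proof -
    have q0: "?q 0 \<theta> = 1" for \<theta> by simp
    have H: "integrable dtheta (\<lambda>\<theta>. 1 / (?q N \<theta>)\<^sup>2)" "(\<integral>\<theta>. 1 / (?q N \<theta>)\<^sup>2 \<partial>dtheta) = 1"
      using integral_opoly_ratio[of "\<lambda>k. - ?a k" 0 N, OF a'] by simp_all
    show int: "integrable dtheta G"
      using G0 by (intro Bochner_Integration.integrable_bound[OF H(1)]) (auto simp: G_def)
    have "integral\<^sup>L dtheta G \<le> (\<integral>\<theta>. 1 / (?q N \<theta>)\<^sup>2 \<partial>dtheta)"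
      using int H(1) by (rule integral_mono) (simp add: G_def)
    then show "integral\<^sup>L dtheta G \<le> 1" using H(2) by simp
  qed

  \<comment> \<open>Majorant of the logarithm of the bound from \<open>opoly_perturbation\<close>,
    built from terms that integrate against \<open>G\<close>.\<close>
  define R where "R \<theta> = ln 2 + (t N \<theta>)\<^sup>2 + (\<Sum>k<N. c k * ((t k \<theta>)\<^sup>2 + (t (Suc k) \<theta>)\<^sup>2))" for \<theta>
  have R0: "R \<theta> \<ge> 0" for \<theta>
    unfolding R_def using c0 by (intro add_nonneg_nonneg sum_nonneg mult_nonneg_nonneg) auto
  have GR: "G \<theta> * R \<theta> = ln 2 * G \<theta> + G \<theta> * (t N \<theta>)\<^sup>2
      + (\<Sum>k<N. c k * (G \<theta> * (t k \<theta>)\<^sup>2 + G \<theta> * (t (Suc k) \<theta>)\<^sup>2))" for \<theta>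
    by (simp add: R_def algebra_simps sum_distrib_left)
  have int_GR: "integrable dtheta (\<lambda>\<theta>. G \<theta> * R \<theta>)"
    unfolding GR using int_t(1) int_G(1)
    by (intro Bochner_Integration.integrable_add Bochner_Integration.integrable_sum integrable_mult_right) auto
  have "(\<integral>\<theta>. G \<theta> * R \<theta> \<partial>dtheta) = ln 2 * integral\<^sup>L dtheta G + (\<integral>\<theta>. G \<theta> * (t N \<theta>)\<^sup>2 \<partial>dtheta)
      + (\<Sum>k<N. c k * ((\<integral>\<theta>. G \<theta> * (t k \<theta>)\<^sup>2 \<partial>dtheta) + (\<integral>\<theta>. G \<theta> * (t (Suc k) \<theta>)\<^sup>2 \<partial>dtheta)))"
    unfolding GR using int_t(1) int_G(1)
    by (subst Bochner_Integration.integral_add Bochner_Integration.integral_sum;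
        (intro Bochner_Integration.integrable_add Bochner_Integration.integrable_sum integrable_mult_right)?; simp)+
  also have "\<dots> \<le> ln 2 * 1 + 4 + (\<Sum>k<N. c k * (4 + 4))"
    using int_t(2) int_G(2) c0 by (intro add_mono sum_mono mult_left_mono) auto
  also have "\<dots> = ln 2 + 4 + 8 * (\<Sum>k<N. c k)"
    by (simp add: sum_distrib_right[symmetric])
  also have "\<dots> \<le> C"
    unfolding C_def using sum_le_suminf[OF c_sum, of "{..<N}"] c0 by simp
  finally have GR_le: "(\<integral>\<theta>. G \<theta> * R \<theta> \<partial>dtheta) \<le> C" .

  let ?B1 = "{\<theta> \<in> K. ?p N \<theta> > T \<or> ?q N \<theta> > T}"
  let ?B2 = "{\<theta> \<in> K. ?x N \<theta> < M}"
  let ?B3 = "{\<theta> \<in> space dtheta. \<gamma> * ln M \<le> G \<theta> * R \<theta>}"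
  have [measurable]: "R \<in> borel_measurable borel" unfolding R_def by measurable
  have meas: "?B1 \<in> sets dtheta" "?B2 \<in> sets dtheta" "?B3 \<in> sets dtheta"
    by (simp_all, measurable)
  have m3: "measure dtheta ?B3 \<le> \<kappa> / 4"
  proof -
    have "measure dtheta ?B3 \<le> (\<integral>\<theta>. G \<theta> * R \<theta> \<partial>dtheta) / (\<gamma> * ln M)"
      using int_GR G0 R0 \<gamma> lnM by (intro integral_Markov_inequality_measure[where A = "{}"]) auto
    also have "\<dots> \<le> C / (\<gamma> * ln M)"
      using GR_le \<gamma> lnM by (intro divide_right_mono) auto
    also have "\<dots> = \<kappa> / 4"
      unfolding M(2) using C \<gamma> \<kappa> by (simp add: field_simps)
    finally show ?thesis .
  qed
  have m2: "measure dtheta ?B2 \<le> \<kappa> / 4"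
  proof -
    interpret B: circle_measure "bernstein_szego ?b N"
      using b by (rule circle_measure_bernstein_szego)
    have cK: "cis ` K \<in> sets circle_borel"
      using cisK by (rule compact_sets_circle_borel)
    have nz: "?x N \<theta> > 0" for \<theta> using opoly_circle_nz[of ?b "cis \<theta>" N] b by simp
    have c: "continuous_on (sphere 0 1) (\<lambda>z. 1 / (cmod (poly (opoly ?b N) z))\<^sup>2)"
      using opoly_circle_nz[of ?b _ N] b by (intro continuous_intros) auto
    obtain B where B: "\<And>\<theta>. \<bar>1 / (?x N \<theta>)\<^sup>2\<bar> \<le> B" using bounded_on_circle[OF c] by blast
    have ind: "(\<lambda>z. indicator (cis ` K) z :: real) \<in> borel_measurable circle_borel"
      using cK by simp
    have ind2: "(\<lambda>\<theta>. indicator (cis ` K) (cis \<theta>) :: real) \<in> borel_measurable borel"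
      by (rule measurable_compose[OF cis_measurable_circle ind])
    have "measure (bernstein_szego ?b N) (cis ` K) = (\<integral>z. indicator (cis ` K) z \<partial>bernstein_szego ?b N)"
      by (simp add: B.space_M Int_absorb2[OF cisK(2)])
    also have "\<dots> = (\<integral>z. 1 / (cmod (poly (opoly ?b N) z))\<^sup>2 * indicator (cis ` K) z \<partial>dtheta_circle)"
      by (subst integral_bernstein_szego[OF ind]) simp
    also have "\<dots> = (\<integral>\<theta>. 1 / (?x N \<theta>)\<^sup>2 * indicator (cis ` K) (cis \<theta>) \<partial>dtheta)"
      by (rule integral_dtheta_circle, rule borel_measurable_times[OF borel_measurable_circle_continuous[OF c] ind])
    finally have BS: "measure (bernstein_szego ?b N) (cis ` K)
        = (\<integral>\<theta>. 1 / (?x N \<theta>)\<^sup>2 * indicator (cis ` K) (cis \<theta>) \<partial>dtheta)" .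
    have "1 / M\<^sup>2 * measure dtheta ?B2 = (\<integral>\<theta>. 1 / M\<^sup>2 * indicator ?B2 \<theta> \<partial>dtheta)"
      by simp
    also have "\<dots> \<le> (\<integral>\<theta>. 1 / (?x N \<theta>)\<^sup>2 * indicator (cis ` K) (cis \<theta>) \<partial>dtheta)"
    proof (rule integral_mono)
      show "integrable dtheta (\<lambda>\<theta>. 1 / M\<^sup>2 * indicator ?B2 \<theta>)"
        using meas(2) by (intro integrable_mult_right integrable_real_indicator) (auto simp: dtheta.emeasure_eq_measure)
      have B0: "0 \<le> B" using order_trans[OF abs_ge_zero B[of 0]] .
      show "integrable dtheta (\<lambda>\<theta>. 1 / (?x N \<theta>)\<^sup>2 * indicator (cis ` K) (cis \<theta>))"
      proof (rule integrable_dtheta_bounded[where B = B])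
        show "(\<lambda>\<theta>. 1 / (?x N \<theta>)\<^sup>2 * indicator (cis ` K) (cis \<theta>)) \<in> borel_measurable borel"
          using ind2 by measurable
        show "\<bar>1 / (?x N \<theta>)\<^sup>2 * indicator (cis ` K) (cis \<theta>)\<bar> \<le> B" for \<theta>
          using B[of \<theta>] B0 by (simp split: split_indicator)
      qed
      show "1 / M\<^sup>2 * indicator ?B2 \<theta> \<le> 1 / (?x N \<theta>)\<^sup>2 * indicator (cis ` K) (cis \<theta>)" for \<theta>
      proof (cases "\<theta> \<in> ?B2")
        case True
        then have "1 / M\<^sup>2 \<le> 1 / (?x N \<theta>)\<^sup>2"
          using nz[of \<theta>] M by (intro divide_left_mono power_mono) auto
        then show ?thesis using True by simp
      qed simp
    qed
    also have "\<dots> \<le> \<kappa> / (4 * M\<^sup>2)" using N BS by simp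
    finally show ?thesis using M(1) by (simp add: field_simps)
  qed
  have "K \<subseteq> ?B1 \<union> (?B2 \<union> ?B3)"
  proof
    fix \<theta> assume \<theta>: "\<theta> \<in> K"
    show "\<theta> \<in> ?B1 \<union> (?B2 \<union> ?B3)"
    proof (rule ccontr)
      assume n: "\<theta> \<notin> ?B1 \<union> (?B2 \<union> ?B3)"
      then have T': "?q N \<theta> \<le> T" and M': "M \<le> ?x N \<theta>" and B3: "G \<theta> * R \<theta> < \<gamma> * ln M"
        using \<theta> by auto
      have q_pos: "?q N \<theta> > 0"
        using opoly_circle_nz[of "\<lambda>k. - ?a k" "cis \<theta>" N] a' by simp
      have "1 / T\<^sup>2 \<le> 1 / (?q N \<theta>)\<^sup>2"
        using q_pos T' T(1) by (intro divide_left_mono power_mono mult_pos_pos zero_less_power) auto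
      then have G: "\<gamma> \<le> G \<theta>"
        using K(3)[OF \<theta>] by (auto simp: G_def \<gamma>_def min_le_iff_disj le_max_iff_disj)
      define \<Sigma> where "\<Sigma> = (\<Sum>k<N. c k * ((t k \<theta>)\<^sup>2 + (t (Suc k) \<theta>)\<^sup>2))"
      have x_le: "?x N \<theta> \<le> 2 * t N \<theta> * exp \<Sigma>"
        using opoly_perturbation[of ?a r ?b lam "cis \<theta>" N, OF a r(2) b r(3) r(1) lam]
        unfolding t_def c_def \<Sigma>_def by simp
      have tN: "t N \<theta> > 0" using q_pos by (simp add: t_eq add_nonneg_pos)
      have "M \<le> 2 * t N \<theta> * exp \<Sigma>" using M' x_le by linarith
      then have "ln M \<le> ln (2 * t N \<theta> * exp \<Sigma>)" using M(1) tN by (subst ln_le_cancel_iff) auto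
      also have "\<dots> = ln 2 + ln (t N \<theta>) + \<Sigma>" using tN by (simp add: ln_mult)
      \<comment> \<open>A crude bound, chosen because the square integrates against
        \<open>G\<close>.\<close>
      also have "ln (t N \<theta>) \<le> (t N \<theta>)\<^sup>2"
      proof -
        have "ln (t N \<theta>) \<le> t N \<theta> - 1" using tN by (rule ln_le_minus_one)
        also have "\<dots> \<le> (t N \<theta>)\<^sup>2" using sum_squares_bound[of "t N \<theta>" 1] tN by simp
        finally show ?thesis .
      qed
      finally have "ln M \<le> R \<theta>" by (simp add: R_def \<Sigma>_def)
      then have "\<gamma> * ln M \<le> G \<theta> * R \<theta>"
        using G G0 lnM \<gamma> by (intro mult_mono) auto
      with B3 show False by simp
    qed
  qed
  then have "\<kappa> \<le> measure dtheta (?B1 \<union> (?B2 \<union> ?B3))"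
    unfolding \<kappa>_def using meas by (intro dtheta.finite_measure_mono) blast+
  also have "\<dots> \<le> measure dtheta ?B1 + measure dtheta (?B2 \<union> ?B3)"
    using meas by (intro measure_Un_le) blast+
  also have "measure dtheta (?B2 \<union> ?B3) \<le> measure dtheta ?B2 + measure dtheta ?B3"
    using meas by (intro measure_Un_le)
  finally show False using T(2)[of N] m2 m3 \<kappa> by linarith
qed

section \<open>From compact sets to almost every angle\<close>

lemma cis_inj_on: "inj_on cis {0..<2 * pi}"
proof (rule inj_on_inverseI)
  fix x :: real assume "x \<in> {0..<2 * pi}"
  then show "Arg2pi (cis x) = x"
    by (intro Arg2pi_unique[of 1]) (auto simp: cis_conv_exp)
qed

lemma AE_dtheta_interval: "AE \<theta> in dtheta. \<theta> \<in> {0..<2 * pi}"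
  unfolding dtheta_def by (rule AE_uniform_measureI) auto

text \<open>Up to a null set, the angles with \<open>w\<close> nonzero and \<open>f\<close> zero lie
  in the union of the \<open>D k\<close>. For compact \<open>K\<close> inside \<open>D k\<close>
  both parts of \<open>\<nu>\<close> vanish on the image of \<open>K\<close>, so \<open>K\<close> is
  null; inner regularity transfers this to \<open>D k\<close>.\<close>

lemma weight_support_perturbed:
  fixes lam :: "nat \<Rightarrow> complex"
  assumes lam: "\<And>n. cmod (lam n) = 1"
    and mu: "nontrivial_prob_on_circle \<mu>" "lebesgue_decomposition \<mu> w \<mu>s"
    and nu: "nontrivial_prob_on_circle \<nu>" "lebesgue_decomposition \<nu> f \<nu>s"
    and sm: "summable (\<lambda>j. cmod (lam j * verblunsky \<mu> j - verblunsky \<nu> j) + cmod (lam (j + 1) * cnj (lam j) - 1))"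
  shows "AE \<theta> in dtheta. w \<theta> \<noteq> 0 \<longrightarrow> f \<theta> \<noteq> 0"
proof -
  interpret N: circle_measure \<nu> using nu(1) by (rule circle_measure_nontrivial)
  have [measurable]: "w \<in> borel_measurable borel" "f \<in> borel_measurable borel"
    using mu(2) nu(2) by (simp_all add: lebesgue_decomposition_def cong: measurable_cong_sets)
  have w0: "AE \<theta> in dtheta. 0 \<le> w \<theta>"
    using mu(2) by (simp add: lebesgue_decomposition_def)
  have sets_\<nu>s: "sets \<nu>s = sets circle_borel"
    using nu(2) by (simp add: lebesgue_decomposition_def mutually_singular_def)
  have "\<exists>S\<in>sets circle_borel. emeasure \<nu>s S = 0 \<and> emeasure dtheta_circle (sphere 0 1 - S) = 0"
    using nu(2) sets_\<nu>s by (simp add: lebesgue_decomposition_def mutually_singular_def)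
  then obtain S where S: "S \<in> sets circle_borel" "emeasure \<nu>s S = 0"
    "emeasure dtheta_circle (sphere 0 1 - S) = 0" by blast
  have S_AE: "AE \<theta> in dtheta. cis \<theta> \<in> S"
  proof (rule AE_I)
    have c: "sphere 0 1 - S \<in> sets circle_borel"
      using sets.compl_sets[OF S(1)] by simp
    show "cis -` (sphere 0 1 - S) \<in> sets dtheta"
      using measurable_sets[OF cis_measurable_circle c] by simp
    show "emeasure dtheta (cis -` (sphere 0 1 - S)) = 0"
      using S(3) c unfolding dtheta_circle_def by (subst (asm) emeasure_distr) simp_all
  qed auto
  \<comment> \<open>The interval makes \<open>cis\<close> injective, \<open>S\<close> excludes the
    singular part of \<open>\<nu>\<close>, and the threshold supplies the constant
    \<open>\<delta>\<close>.\<close>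
  define D where "D k = {\<theta> \<in> {0..<2 * pi}. f \<theta> \<le> 0 \<and> cis \<theta> \<in> S \<and> w \<theta> \<ge> 1 / real (Suc k)}" for k
  have cisS: "{\<theta>. cis \<theta> \<in> S} \<in> sets borel"
    using measurable_sets[OF cis_measurable_circle S(1)] by (simp add: vimage_def)
  have D_meas: "D k \<in> sets borel" for k
  proof -
    have "D k = {0..<2 * pi} \<inter> {\<theta>. cis \<theta> \<in> S} \<inter> {\<theta>. f \<theta> \<le> 0} \<inter> {\<theta>. w \<theta> \<ge> 1 / real (Suc k)}"
      by (auto simp: D_def)
    then show ?thesis using cisS by simp
  qed
  have compact_null: "emeasure dtheta K = 0" if K: "K \<subseteq> D k" "compact K" for K k
  proof -
    have cisK: "compact (cis ` K)" "cis ` K \<subseteq> sphere 0 1"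
      using K(2) by (auto intro!: compact_continuous_image continuous_intros)
    have cK: "cis ` K \<in> sets circle_borel"
      using cisK by (rule compact_sets_circle_borel)
    have "emeasure \<nu>s (cis ` K) \<le> emeasure \<nu>s S"
      using K(1) S(1) sets_\<nu>s by (intro emeasure_mono) (auto simp: D_def)
    then have s0: "emeasure \<nu>s (cis ` K) = 0" using S(2) by simp
    have "emeasure (distr (density dtheta (\<lambda>\<theta>. ennreal (f \<theta>))) circle_borel cis) (cis ` K)
        = emeasure (density dtheta (\<lambda>\<theta>. ennreal (f \<theta>))) (cis -` (cis ` K))"
      using cK by (subst emeasure_distr) simp_all
    also have "\<dots> = (\<integral>\<^sup>+\<theta>. ennreal (f \<theta>) * indicator (cis -` (cis ` K)) \<theta> \<partial>dtheta)"
      using measurable_sets[OF cis_measurable_circle cK] by (subst emeasure_density) auto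
    also have "\<dots> = (\<integral>\<^sup>+\<theta>. 0 \<partial>dtheta)"
    proof (rule nn_integral_cong_AE)
      \<comment> \<open>The preimage also contains translates of \<open>K\<close> by multiples of
        \<open>2 * pi\<close>, where \<open>f\<close> is unknown, but \<open>dtheta\<close> does not
        charge them.\<close>
      show "AE \<theta> in dtheta. ennreal (f \<theta>) * indicator (cis -` (cis ` K)) \<theta> = 0"
        using AE_dtheta_interval
      proof eventually_elim
        case (elim \<theta>)
        have "f \<theta> \<le> 0" if cis: "cis \<theta> \<in> cis ` K"
        proof -
          obtain x where x: "x \<in> K" "cis \<theta> = cis x" using cis by blast
          then have "x \<in> {0..<2 * pi}" using K(1) by (auto simp: D_def)
          then have "\<theta> = x" using inj_onD[OF cis_inj_on x(2) elim] by simp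
          then show ?thesis using x(1) K(1) by (auto simp: D_def)
        qed
        then show ?case by (auto simp: ennreal_neg split: split_indicator)
      qed
    qed
    finally have "emeasure \<nu> (cis ` K) = 0"
      using nu(2) cK N.sets_M s0 by (simp add: lebesgue_decomposition_def)
    then have n0: "measure \<nu> (cis ` K) = 0" by (simp add: measure_def)
    have "measure dtheta K = 0"
      by (rule measure_zero_if_perturbed_null[OF lam mu nu(1) K(2), of "1 / real (Suc k)"])
         (use K(1) n0 sm in \<open>auto simp: D_def\<close>)
    then show ?thesis by (simp add: dtheta.emeasure_eq_measure)
  qed
  have "emeasure dtheta (D k) = 0" for k
  proof -
    have "emeasure dtheta (D k) = (SUP K\<in>{K. K \<subseteq> D k \<and> compact K}. emeasure dtheta K)"
      using D_meas by (intro inner_regular) auto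
    also have "\<dots> = (SUP K\<in>{K. K \<subseteq> D k \<and> compact K}. 0)"
      using compact_null by (intro SUP_cong) auto
    also have "\<dots> = 0"
      by (simp add: SUP_constant bot_ennreal)
    finally show ?thesis .
  qed
  then have "D k \<in> null_sets dtheta" for k
    using D_meas by (simp add: null_sets_def)
  then have "(\<Union>k. D k) \<in> null_sets dtheta"
    by (intro null_sets_UN) auto
  then have "AE \<theta> in dtheta. \<theta> \<notin> (\<Union>k. D k)"
    by (rule AE_not_in)
  with w0 S_AE AE_dtheta_interval show ?thesis
  proof eventually_elim
    case (elim \<theta>)
    show ?case
    proof (intro impI notI)
      assume "w \<theta> \<noteq> 0" "f \<theta> = 0"
      then have "w \<theta> > 0" using elim by simp
      then obtain k where "1 / real (Suc k) < w \<theta>"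
        using nat_approx_posE by blast
      then have "\<theta> \<in> D k"
        unfolding D_def mem_Collect_eq using elim(2,3) \<open>f \<theta> = 0\<close> by (intro conjI) simp_all
      then show False using elim(4) by blast
    qed
  qed
qed

text \<open>The summability condition is symmetric: exchanging the measures and conjugating
  \<open>lam\<close> changes no term, because \<open>lam\<close> is unimodular. The one-sided result
  therefore applies in both directions.\<close>

theorem theorem3p5:
  fixes lam :: "nat \<Rightarrow> complex"
    and \<mu> \<nu> \<mu>s \<nu>s :: "complex measure"
    and w f :: "real \<Rightarrow> real"
    and \<alpha> \<beta> :: "nat \<Rightarrow> complex"
  assumes "\<And>n. lam n \<in> sphere 0 1"
    and "nontrivial_prob_on_circle \<mu>"
    and "nontrivial_prob_on_circle \<nu>"
    and "lebesgue_decomposition \<mu> w \<mu>s"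
    and "lebesgue_decomposition \<nu> f \<nu>s"
    and "\<And>n. \<alpha> n = verblunsky \<mu> n"
    and "\<And>n. \<beta> n = verblunsky \<nu> n"
    and "summable (\<lambda>j. cmod (lam j * \<alpha> j - \<beta> j) + cmod (lam (j + 1) * cnj (lam j) - 1))"
  shows "sym_diff {\<theta>. w \<theta> \<noteq> 0} {\<theta>. f \<theta> \<noteq> 0} \<in> null_sets dtheta"
proof -
  have [measurable]: "w \<in> borel_measurable borel" "f \<in> borel_measurable borel"
    using assms(4,5) by (simp_all add: lebesgue_decomposition_def cong: measurable_cong_sets)
  have lam: "cmod (lam n) = 1" for n using assms(1)[of n] by simp
  have lam': "cmod (cnj (lam n)) = 1" for n using lam by simp
  have sm: "summable (\<lambda>j. cmod (lam j * verblunsky \<mu> j - verblunsky \<nu> j) + cmod (lam (j + 1) * cnj (lam j) - 1))"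
    using assms(8) unfolding assms(6,7) .
  have swap: "cmod (cnj l * y - x) = cmod (l * x - y)" if "cmod l = 1" for l x y
  proof -
    have "l * (cnj l * y - x) = (l * cnj l) * y - l * x"
      by (simp add: algebra_simps)
    then have "l * (cnj l * y - x) = y - l * x"
      using circle_mult_cnj[OF that] by simp
    then have "cmod l * cmod (cnj l * y - x) = cmod (y - l * x)"
      by (metis norm_mult)
    then show ?thesis using that by (simp add: norm_minus_commute)
  qed
  have swap2: "cmod (cnj l' * cnj (cnj l) - 1) = cmod (l' * cnj l - 1)" for l l'
    using complex_mod_cnj[of "l' * cnj l - 1"] by simp
  have sm': "summable (\<lambda>j. cmod (cnj (lam j) * verblunsky \<nu> j - verblunsky \<mu> j)
      + cmod (cnj (lam (j + 1)) * cnj (cnj (lam j)) - 1))"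
    using sm unfolding swap[OF lam] swap2 .
  have "AE \<theta> in dtheta. w \<theta> \<noteq> 0 \<longrightarrow> f \<theta> \<noteq> 0"
    using weight_support_perturbed[OF lam assms(2,4,3,5) sm] .
  moreover have "AE \<theta> in dtheta. f \<theta> \<noteq> 0 \<longrightarrow> w \<theta> \<noteq> 0"
    using weight_support_perturbed[OF lam' assms(3,5,2,4) sm'] .
  ultimately have "AE \<theta> in dtheta. \<theta> \<notin> sym_diff {\<theta>. w \<theta> \<noteq> 0} {\<theta>. f \<theta> \<noteq> 0}"
    by eventually_elim auto
  then show ?thesis
    by (subst AE_iff_null_sets) (auto simp del: Un_iff)
qed

end
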